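(* Let $\psi$ be an increasing slowly varying function with $\psi(x)\gg\log x$. Let $f$ be a positive, locally integrable real function on $[1,\infty)$ satisfying: (i) $(x\psi(x))^{1/h}\ll f(x)\ll\min\{(x\psi(x))^{1/(h-1)},\,x\}$; and (ii) $\int_1^x \frac{f(t)}{t}\,dt\asymp f(x)$. Then there exists $A\subseteq\mathbb{Z}_{\ge0}$ such that $|A\cap[1,x]|\asymp f(x)$ and $r_{A,h}(n)\asymp f(n)^h/n$.
   Context: Fix an integer $h\ge 2$ and positive integers $b_1,\dots,b_h$, not necessarily distinct, with $\gcd(b_1,\dots,b_h)=1$. For $A\subseteq\mathbb{Z}_{\ge 0}$, $1\le\ell\le h$ and an integer $n\ge 0$, let $r_{A,\ell}(n)$ be the number of $\ell$-tuples $(k_1,\dots,k_\ell)\in A^\ell$ with $b_1k_1+\cdots+b_\ell k_\ell=n$. A function $\psi$ is slowly varying if it is positive and measurable and $\psi(\lambda x)/\psi(x)\to1$ as $x\to\infty$ for every real $\lambda>0$. Asymptotic notation: $X\ll Y$ means $|X|\le CY$ for some constant $C>0$ and all sufficiently large values of the variable. $X\asymp Y$ means $X\ll Y$ and $Y\ll X$. *)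

theory Defs
  imports "HOL-Analysis.Analysis" "HOL-Library.Landau_Symbols"
begin

text \<open>r_{A,l}(n): number of l-tuples (k_1,...,k_l) in A^l with b_1 k_1 + ... + b_l k_l = n.
  Tuples are represented as functions on {1..l}, extended by 0 outside.\<close>
definition rep_count :: "(nat \<Rightarrow> nat) \<Rightarrow> nat set \<Rightarrow> nat \<Rightarrow> nat \<Rightarrow> nat" where
  "rep_count b A l n = card {k :: nat \<Rightarrow> nat.
      (\<forall>i. i \<notin> {1..l} \<longrightarrow> k i = 0) \<and> (\<forall>i\<in>{1..l}. k i \<in> A) \<and>
      (\<Sum>i=1..l. b i * k i) = n}"

definition slowly_varying :: "(real \<Rightarrow> real) \<Rightarrow> bool" where
  "slowly_varying \<psi> \<longleftrightarrow> (\<forall>x\<ge>1. \<psi> x > 0) \<and> set_borel_measurable lborel {1..} \<psi> \<and>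
     (\<forall>c>0. ((\<lambda>x. \<psi> (c * x) / \<psi> x) \<longlongrightarrow> 1) at_top)"

end

theory Submission
  imports Defs "HOL-Probability.Product_PMF" "HOL-Real_Asymp.Real_Asymp"
begin

text \<open>
  Replace \<open>f\<close> by \<open>F x = integral {1..x} (f t / t)\<close>, which is increasing and doubling and grows at
  least like a power, and let every \<open>k\<close> belong to \<open>A\<close> with probability \<open>p k = G k / k\<close>, where
  \<open>G n = min n (K * F n)\<close> and \<open>K\<close> is a large constant.  A representation of \<open>n\<close> is sorted by its
  largest entry \<open>k\<close>: the number \<open>w k\<close> of representations with largest entry \<open>k\<close> depends only on the
  members of \<open>A\<close> below \<open>k\<close>, so the number of representations, \<open>\<Sum>k\<in>A. w k\<close>, satisfies a martingale
  Chernoff bound around \<open>\<Sum>k. p k * w k\<close>.  Since \<open>k\<close> has the order of magnitude of \<open>n\<close>, the latter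
  sum is of order \<open>p n\<close> times the number of choices of the remaining entries, which is controlled by
  the counting function of \<open>A\<close> alone.  The size of the individual \<open>w k\<close> is controlled by the same
  inequality for fewer summands: with at most \<open>h - 2\<close> summands (and with \<open>h - 1\<close> summands at integers
  where \<open>G\<close> is small) the number of representations is bounded, with \<open>h - 1\<close> summands it is \<open>O(\<psi>)\<close>.

  No probability space is needed: the exponential moments are supermartingales, so membership in
  \<open>A\<close> can be decided for one \<open>k\<close> after the other without increasing a weighted sum of all of them.
\<close>

subsection \<open>Derandomised exponential moment bounds\<close>

definition predictable :: "(nat \<Rightarrow> nat set \<Rightarrow> 'a) \<Rightarrow> bool" where
  "predictable u \<longleftrightarrow> (\<forall>k X. u k (X \<inter> {..<k}) = u k X)"

text \<open>If every \<open>k\<close> belongs to \<open>X\<close> independently with probability \<open>p k\<close>, the exponential of the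
  following sum is a supermartingale in \<open>n\<close>.\<close>

definition compensated_sum ::
    "(nat \<Rightarrow> real) \<Rightarrow> (nat \<Rightarrow> nat set \<Rightarrow> real) \<Rightarrow> nat set \<Rightarrow> nat \<Rightarrow> real" where
  "compensated_sum p u X n = (\<Sum>k<n. (if k \<in> X then u k X else 0) - p k * (exp (u k X) - 1))"

lemma predictable_cong:
  assumes "predictable u" "X \<inter> {..<n} = Y \<inter> {..<n}" "k \<le> n"
  shows "u k X = u k Y"
proof -
  have "Z \<inter> {..<k} = Z \<inter> {..<n} \<inter> {..<k}" for Z :: "nat set" using \<open>k \<le> n\<close> by auto
  then have "X \<inter> {..<k} = Y \<inter> {..<k}" using assms(2) by metis
  then show ?thesis using assms(1) unfolding predictable_def by metis
qed

lemma compensated_sum_cong: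
  assumes "predictable u" "X \<inter> {..<n} = Y \<inter> {..<n}"
  shows "compensated_sum p u X n = compensated_sum p u Y n"
  unfolding compensated_sum_def
proof (rule sum.cong)
  fix k assume "k \<in> {..<n}"
  then have "u k X = u k Y" "k \<in> X \<longleftrightarrow> k \<in> Y"
    using predictable_cong[OF assms, of k] assms(2) by auto
  then show "(if k \<in> X then u k X else 0) - p k * (exp (u k X) - 1) =
      (if k \<in> Y then u k Y else 0) - p k * (exp (u k Y) - 1)" by simp
qed simp

lemma exp_compensated_sum_supermartingale:
  assumes pred: "predictable u" and X_prefix: "X \<subseteq> {..<n}"
  shows "p n * exp (compensated_sum p u (insert n X) (Suc n)) +
    (1 - p n) * exp (compensated_sum p u X (Suc n)) \<le> exp (compensated_sum p u X n)"
    (is "?avg \<le> exp ?s")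
proof -
  let ?c = "p n * (exp (u n X) - 1)"
  have prefix_eq: "insert n X \<inter> {..<n} = X \<inter> {..<n}" using X_prefix by auto
  have "compensated_sum p u (insert n X) (Suc n) = ?s + u n X - ?c"
    using compensated_sum_cong[OF pred prefix_eq] predictable_cong[OF pred prefix_eq order_refl]
    by (simp add: compensated_sum_def)
  moreover have "compensated_sum p u X (Suc n) = ?s - ?c"
    using X_prefix by (auto simp: compensated_sum_def)
  ultimately have "?avg = exp ?s * ((1 + ?c) * exp (- ?c))"
    by (simp only: exp_add exp_diff exp_minus) (simp add: divide_inverse algebra_simps)
  also have "(1 + x) * exp (- x) \<le> 1" for x :: real
    using exp_ge_add_one_self[of x] by (simp add: exp_minus field_simps)
  then have "exp ?s * ((1 + ?c) * exp (- ?c)) \<le> exp ?s * 1" by (intro mult_left_mono) auto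
  finally show ?thesis by simp
qed

lemma UN_coherent_prefixes:
  fixes X :: "nat \<Rightarrow> nat set"
  assumes "\<And>n. X (Suc n) \<inter> {..<n} = X n"
  shows "(\<Union>n. X n) \<inter> {..<n} = X n"
proof -
  have prefix: "X m \<inter> {..<n} = X n" if "n < m" for m n
    using that
  proof (induction rule: less_Suc_induct)
    case (2 i j k)
    have "X k \<inter> {..<i} = X k \<inter> {..<j} \<inter> {..<i}" using \<open>i < j\<close> by auto
    with 2 show ?case by simp
  qed (rule assms)
  have "X m \<inter> {..<n} \<subseteq> X n" for m
    using prefix[of m n] prefix[of n m] by (cases m n rule: linorder_cases) auto
  moreover have "X n \<subseteq> {..<n}" using assms[of n] by blast
  ultimately show ?thesis by blast
qed

definition potential ::
    "(nat \<Rightarrow> real) \<Rightarrow> ('j \<Rightarrow> nat \<Rightarrow> nat set \<Rightarrow> real) \<Rightarrow> ('j \<Rightarrow> real) \<Rightarrow> 'j set \<Rightarrow>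
      nat set \<Rightarrow> nat \<Rightarrow> ennreal" where
  "potential p u a J X n = (\<integral>\<^sup>+j. ennreal (a j * exp (compensated_sum p (u j) X n)) \<partial>count_space J)"

lemma potential_supermartingale:
  assumes p_range: "0 \<le> p n" "p n \<le> 1" and pred: "\<And>j. j \<in> J \<Longrightarrow> predictable (u j)"
    and weights: "\<And>j. 0 \<le> a j" and X_prefix: "X \<subseteq> {..<n}"
  shows "ennreal (p n) * potential p u a J (insert n X) (Suc n) +
    ennreal (1 - p n) * potential p u a J X (Suc n) \<le> potential p u a J X n"
proof -
  let ?e = "\<lambda>j X n. exp (compensated_sum p (u j) X n)"
  have "ennreal (p n) * ennreal (a j * ?e j (insert n X) (Suc n)) +
      ennreal (1 - p n) * ennreal (a j * ?e j X (Suc n)) \<le> ennreal (a j * ?e j X n)"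
    if "j \<in> J" for j
  proof -
    have "p n * (a j * ?e j (insert n X) (Suc n)) + (1 - p n) * (a j * ?e j X (Suc n)) =
        a j * (p n * ?e j (insert n X) (Suc n) + (1 - p n) * ?e j X (Suc n))"
      by (simp add: algebra_simps)
    also have "\<dots> \<le> a j * ?e j X n"
      using exp_compensated_sum_supermartingale[OF pred[OF that] X_prefix] weights
      by (intro mult_left_mono) auto
    finally show ?thesis
      using p_range weights
      by (simp add: ennreal_mult[symmetric] ennreal_plus[symmetric] del: ennreal_plus)
  qed
  then have "(\<integral>\<^sup>+j. ennreal (p n) * ennreal (a j * ?e j (insert n X) (Suc n)) +
      ennreal (1 - p n) * ennreal (a j * ?e j X (Suc n)) \<partial>count_space J) \<le> potential p u a J X n"
    unfolding potential_def by (intro nn_integral_mono) auto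
  then show ?thesis by (simp add: potential_def nn_integral_cmult nn_integral_add)
qed

lemma potential_extend:
  assumes p_range: "0 \<le> p n" "p n \<le> 1" and pred: "\<And>j. j \<in> J \<Longrightarrow> predictable (u j)"
    and weights: "\<And>j. 0 \<le> a j" and X_prefix: "X \<subseteq> {..<n}"
    and potential_less: "potential p u a J X n < 1"
  shows "potential p u a J X (Suc n) < 1 \<or> p n > 0 \<and> potential p u a J (insert n X) (Suc n) < 1"
proof (rule ccontr)
  let ?in = "potential p u a J (insert n X) (Suc n)" and ?out = "potential p u a J X (Suc n)"
  assume "\<not> ?thesis"
  then have out_ge: "1 \<le> ?out" and in_ge: "p n > 0 \<Longrightarrow> 1 \<le> ?in" by (auto simp: not_less[symmetric])
  have "ennreal (p n) * 1 \<le> ennreal (p n) * ?in"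
    using in_ge p_range by (cases "p n = 0") (auto intro!: mult_left_mono simp del: mult_1_right)
  moreover have "ennreal (1 - p n) * 1 \<le> ennreal (1 - p n) * ?out"
    using out_ge by (intro mult_left_mono) auto
  ultimately have "ennreal (p n) * 1 + ennreal (1 - p n) * 1 \<le> potential p u a J X n"
    using potential_supermartingale[of p n J u a X, OF p_range pred weights X_prefix]
    by (meson add_mono order_trans)
  then show False
    using potential_less p_range by (simp add: ennreal_plus[symmetric] del: ennreal_plus)
qed

lemma derandomization:
  assumes p_range: "\<And>k. 0 \<le> p k" "\<And>k. p k \<le> 1"
    and pred: "\<And>j. j \<in> J \<Longrightarrow> predictable (u j)"
    and weights: "\<And>j. 0 \<le> a j" "(\<integral>\<^sup>+j. ennreal (a j) \<partial>count_space J) < 1"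
  shows "\<exists>A. (\<forall>k\<in>A. p k > 0) \<and> (\<forall>j\<in>J. \<forall>n. a j * exp (compensated_sum p (u j) A n) < 1)"
proof -
  define good where
    "good n X \<longleftrightarrow> X \<subseteq> {..<n} \<and> (\<forall>k\<in>X. p k > 0) \<and> potential p u a J X n < 1" for n X
  have "\<exists>Y. good (Suc n) Y \<and> Y \<inter> {..<n} = X" if "good n X" for n X
  proof -
    have X_prefix: "X \<subseteq> {..<n}" "\<forall>k\<in>X. p k > 0" "potential p u a J X n < 1"
      using that by (auto simp: good_def)
    then have "X \<inter> {..<n} = X" "insert n X \<inter> {..<n} = X" "X \<subseteq> {..<Suc n}" by auto
    then show ?thesis
      using potential_extend[of p n J u a X, OF p_range pred weights(1) X_prefix(1,3)] X_prefix(2)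
      unfolding good_def
      by (metis insert_iff insert_subset lessThan_iff lessI)
  qed
  moreover have "good 0 {}" using weights by (simp add: good_def potential_def compensated_sum_def)
  ultimately obtain X where X_prefix: "\<And>n. good n (X n)" "\<And>n. X (Suc n) \<inter> {..<n} = X n"
    using dependent_nat_choice[of good "\<lambda>n X Y. Y \<inter> {..<n} = X"] by metis
  define A where "A = (\<Union>n. X n)"
  have "a j * exp (compensated_sum p (u j) A n) < 1" if "j \<in> J" for j n
  proof -
    have "A \<inter> {..<n} = X n \<inter> {..<n}"
      using UN_coherent_prefixes[OF X_prefix(2), of n] by (auto simp: A_def)
    then have "ennreal (a j * exp (compensated_sum p (u j) A n))
        = ennreal (a j * exp (compensated_sum p (u j) (X n) n))"
      using compensated_sum_cong[OF pred[OF that]] by metis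
    also have "\<dots> \<le> potential p u a J (X n) n"
      unfolding potential_def using that by (rule nn_integral_ge_point)
    also have "\<dots> < 1" using X_prefix(1) by (simp add: good_def)
    finally show ?thesis using weights(1) by simp
  qed
  moreover have "\<forall>k\<in>A. p k > 0" using X_prefix(1) by (auto simp: A_def good_def)
  ultimately show ?thesis by blast
qed

lemma nn_integral_telescoping_reciprocals:
  assumes "finite U" "k0 \<ge> 2"
  shows "(\<integral>\<^sup>+(u, n). ennreal (1 / (real n - 1) - 1 / real n) \<partial>count_space (U \<times> {k0..}))
    = ennreal (real (card U) / (real k0 - 1))"
proof -
  let ?d = "\<lambda>n. 1 / (real n - 1) - 1 / real n"
  interpret pair_sigma_finite "count_space U" "count_space {k0..}"
    using \<open>finite U\<close> by (intro pair_sigma_finite.intro sigma_finite_measure_count_space_countable)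
      (auto intro: countable_finite)
  have "(\<integral>\<^sup>+(u, n). ennreal (?d n) \<partial>count_space (U \<times> {k0..}))
      = (\<integral>\<^sup>+n. \<integral>\<^sup>+u. ennreal (?d n) \<partial>count_space U \<partial>count_space {k0..})"
    using \<open>finite U\<close> nn_integral_snd[of "\<lambda>(u, n). ennreal (?d n)"]
    by (simp add: pair_measure_countable countable_finite)
  also have "\<dots> = (\<integral>\<^sup>+n. ennreal (real (card U)) * ennreal (?d n) \<partial>count_space {k0..})"
    using \<open>finite U\<close> by (simp add: ennreal_of_nat_eq_real_of_nat mult.commute)
  also have "\<dots> = ennreal (real (card U)) * (\<integral>\<^sup>+n. ennreal (?d n) \<partial>count_space {k0..})"
    by (rule nn_integral_cmult) simp
  also have "(\<integral>\<^sup>+n. ennreal (?d n) \<partial>count_space {k0..}) = (\<Sum>n. ennreal (?d (n + k0)))"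
    by (subst nn_integral_bij_count_space[of "\<lambda>n. n + k0" UNIV, symmetric])
      (auto simp: nn_integral_count_space_nat intro!: bij_betwI[of _ _ _ "\<lambda>n. n - k0"])
  also have "\<dots> = ennreal (1 / (real k0 - 1))"
  proof (rule suminf_ennreal_eq)
    have "(\<lambda>n. 1 / (real (n + k0) - 1)) \<longlonglongrightarrow> 0" by real_asymp
    from telescope_sums'[OF this] show "(\<lambda>n. ?d (n + k0)) sums (1 / (real k0 - 1))" by simp
    show "0 \<le> ?d (n + k0)" for n using \<open>k0 \<ge> 2\<close> by (simp add: frac_le)
  qed
  finally show ?thesis using \<open>k0 \<ge> 2\<close> by (simp add: ennreal_mult[symmetric])
qed

lemma simultaneous_exponential_bounds:
  fixes p :: "nat \<Rightarrow> real" and U :: "(nat \<Rightarrow> nat \<Rightarrow> nat set \<Rightarrow> real) set"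
  assumes p_range: "\<And>k. 0 \<le> p k" "\<And>k. p k \<le> 1"
    and tests: "finite U" "\<And>u n. u \<in> U \<Longrightarrow> predictable (u n)" and k0_large: "k0 \<ge> card U + 2"
  shows "\<exists>A. (\<forall>k\<in>A. p k > 0) \<and>
    (\<forall>u\<in>U. \<forall>n\<ge>k0. \<forall>N. compensated_sum p (u n) A N \<le> 2 * ln (real n))"
proof -
  let ?a = "\<lambda>j. max 0 (1 / (real (snd j) - 1) - 1 / real (snd j))"
  have "(\<integral>\<^sup>+j. ennreal (?a j) \<partial>count_space (U \<times> {k0..})) = ennreal (real (card U) / (real k0 - 1))"
    using nn_integral_telescoping_reciprocals[OF tests(1), of k0] k0_large
    by (simp add: case_prod_unfold ennreal_max_0)
  also have "\<dots> < 1" using k0_large by (simp add: ennreal_less_one_iff)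
  finally obtain A where A_props: "\<forall>k\<in>A. p k > 0"
    "\<forall>j\<in>U \<times> {k0..}. \<forall>N. ?a j * exp (compensated_sum p (fst j (snd j)) A N) < 1"
    using derandomization[of p "U \<times> {k0..}" "\<lambda>j. fst j (snd j)" ?a] p_range tests(2) by fastforce
  have "compensated_sum p (u n) A N \<le> 2 * ln (real n)" if "u \<in> U" "n \<ge> k0" for u n N
  proof -
    have n_ge: "real n \<ge> 2" using that k0_large by linarith
    have "1 / (real n)\<^sup>2 \<le> 1 / (real n - 1) - 1 / real n"
      using n_ge by (simp add: field_simps power2_eq_square)
    then have "1 / (real n)\<^sup>2 * exp (compensated_sum p (u n) A N)
        \<le> ?a (u, n) * exp (compensated_sum p (u n) A N)"
      by (intro mult_right_mono) auto
    also have "\<dots> < 1" using A_props(2) that by fastforce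
    finally have "exp (compensated_sum p (u n) A N) < exp (2 * ln (real n))"
      using n_ge by (simp add: exp_of_nat_mult[of 2, simplified] divide_less_eq)
    then show ?thesis by simp
  qed
  then show ?thesis using A_props(1) by blast
qed

lemma sum_members_le:
  assumes p_nonneg: "\<And>k. 0 \<le> p k" and l_pos: "l > 0"
    and bound: "compensated_sum p (\<lambda>k X. l * w k X) A (Suc n) \<le> c"
  shows "(\<Sum>k\<in>A \<inter> {..n}. w k A) \<le> (\<Sum>k\<le>n. p k * (w k A * exp (l * w k A))) + c / l"
proof -
  have "exp x - 1 \<le> x * exp x" for x :: real
    using exp_ge_add_one_self[of "- x"] by (simp add: exp_minus field_simps)
  then have "p k * (exp (l * w k A) - 1) \<le> p k * (l * w k A * exp (l * w k A))" for k
    by (intro mult_left_mono p_nonneg)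
  then have "p k * (exp (l * w k A) - 1) \<le> l * (p k * (w k A * exp (l * w k A)))" for k
    by (simp only: mult_ac)
  then have "l * (\<Sum>k\<in>A \<inter> {..n}. w k A) - l * (\<Sum>k\<le>n. p k * (w k A * exp (l * w k A)))
      \<le> (\<Sum>k\<le>n. if k \<in> A then l * w k A else 0) - (\<Sum>k\<le>n. p k * (exp (l * w k A) - 1))"
    by (intro diff_mono)
      (auto simp: sum.inter_restrict[symmetric] Int_commute sum_distrib_left intro!: sum_mono)
  also have "\<dots> \<le> c" using bound by (simp add: compensated_sum_def sum_subtractf lessThan_Suc_atMost)
  finally show ?thesis using l_pos by (simp add: field_simps)
qed

lemma sum_members_ge:
  assumes p_nonneg: "\<And>k. 0 \<le> p k" and l_pos: "l > 0"
    and w_range: "\<And>k. 0 \<le> w k A" "\<And>k. l * w k A \<le> 1"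
    and bound: "compensated_sum p (\<lambda>k X. - (l * w k X)) A (Suc n) \<le> c"
  shows "(\<Sum>k\<le>n. p k * w k A) / 2 - c / l \<le> (\<Sum>k\<in>A \<inter> {..n}. w k A)"
proof -
  have "exp (- x) - 1 \<le> - x / 2" if "0 \<le> x" "x \<le> 1" for x :: real
  proof -
    have "exp (- x) \<le> 1 / (1 + x)"
      using exp_ge_add_one_self[of x] that by (simp add: exp_minus field_simps)
    also have "\<dots> \<le> 1 - x / 2"
      using mult_left_mono[OF that(2,1)] that by (simp add: field_simps)
    finally show ?thesis by simp
  qed
  then have "p k * (exp (- (l * w k A)) - 1) \<le> p k * (- (l * w k A) / 2)" for k
    using w_range l_pos by (intro mult_left_mono p_nonneg) auto
  then have "p k * (exp (- (l * w k A)) - 1) \<le> - l / 2 * (p k * w k A)" for k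
    by (simp add: mult_ac)
  then have "- l * (\<Sum>k\<in>A \<inter> {..n}. w k A) - (- l / 2) * (\<Sum>k\<le>n. p k * w k A)
      \<le> (\<Sum>k\<le>n. if k \<in> A then - (l * w k A) else 0) - (\<Sum>k\<le>n. p k * (exp (- (l * w k A)) - 1))"
    unfolding sum_distrib_left
    by (intro diff_mono) (auto simp: sum.inter_restrict[symmetric] Int_commute intro!: sum_mono)
  also have "\<dots> \<le> c" using bound by (simp add: compensated_sum_def sum_subtractf lessThan_Suc_atMost)
  finally show ?thesis using l_pos by (simp add: field_simps)
qed

subsection \<open>Representations by a linear form\<close>

definition rep_tuples :: "('i \<Rightarrow> nat) \<Rightarrow> 'i set \<Rightarrow> nat set \<Rightarrow> nat \<Rightarrow> ('i \<Rightarrow> nat) set" where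
  "rep_tuples b I A n = {\<kappa> \<in> PiE_dflt I 0 (\<lambda>_. A). (\<Sum>i\<in>I. b i * \<kappa> i) = n}"

definition num_reps :: "('i \<Rightarrow> nat) \<Rightarrow> 'i set \<Rightarrow> nat set \<Rightarrow> nat \<Rightarrow> nat" where
  "num_reps b I A n = card (rep_tuples b I A n)"

text \<open>For \<open>k \<in> X\<close> the number of representations of \<open>n\<close> by members of \<open>X\<close> with largest entry \<open>k\<close>,
  attained exactly on the index set \<open>S\<close>; it does not depend on which \<open>m \<ge> k\<close> belong to \<open>X\<close>.\<close>

definition num_top_reps :: "('i \<Rightarrow> nat) \<Rightarrow> 'i set \<Rightarrow> 'i set \<Rightarrow> nat \<Rightarrow> nat \<Rightarrow> nat set \<Rightarrow> nat" where
  "num_top_reps b I S n k X =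
    (if sum b S * k \<le> n then num_reps b (I - S) (X \<inter> {..<k}) (n - sum b S * k) else 0)"

lemma rep_count_eq_num_reps: "rep_count b A h n = num_reps b {1..h} A n"
  unfolding rep_count_def num_reps_def rep_tuples_def PiE_dflt_def
  by (intro arg_cong[of _ _ card]) auto

lemma rep_tuples_entry_le:
  assumes "finite I" "\<kappa> \<in> rep_tuples b I A n" "i \<in> I" "b i > 0"
  shows "\<kappa> i \<le> n"
proof -
  have "\<kappa> i \<le> b i * \<kappa> i" using assms by simp
  also have "\<dots> \<le> (\<Sum>i\<in>I. b i * \<kappa> i)" using assms by (intro member_le_sum) auto
  finally show ?thesis using assms by (simp add: rep_tuples_def)
qed

lemma rep_tuples_subset_PiE_dflt:
  assumes "finite I" "\<forall>i\<in>I. b i > 0"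
  shows "rep_tuples b I A n \<subseteq> PiE_dflt I 0 (\<lambda>_. A \<inter> {..n})"
proof
  fix \<kappa> assume \<kappa>_in: "\<kappa> \<in> rep_tuples b I A n"
  then have "\<kappa> i \<le> n" if "i \<in> I" for i
    using assms that by (intro rep_tuples_entry_le) auto
  then show "\<kappa> \<in> PiE_dflt I 0 (\<lambda>_. A \<inter> {..n})"
    using \<kappa>_in by (auto simp: rep_tuples_def PiE_dflt_def)
qed

lemma finite_rep_tuples:
  assumes "finite I" "\<forall>i\<in>I. b i > 0"
  shows "finite (rep_tuples b I A n)"
  using rep_tuples_subset_PiE_dflt[OF assms] by (rule finite_subset) (use assms in auto)

lemma num_reps_mono:
  assumes "finite I" "\<forall>i\<in>I. b i > 0" "A \<subseteq> B"
  shows "num_reps b I A n \<le> num_reps b I B n"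
  unfolding num_reps_def using assms(3)
  by (intro card_mono finite_rep_tuples assms) (auto simp: rep_tuples_def PiE_dflt_def)

lemma num_reps_empty_index_le: "num_reps b {} A n \<le> 1"
proof -
  have "rep_tuples b {} A n \<subseteq> {\<lambda>_. 0}" by (auto simp: rep_tuples_def PiE_dflt_def)
  then have "card (rep_tuples b {} A n) \<le> card {\<lambda>_::'a. 0::nat}" by (intro card_mono) auto
  then show ?thesis by (simp add: num_reps_def)
qed

lemma num_reps_eq_0_if_less:
  assumes "finite I" "\<forall>i\<in>I. b i > 0" "I \<noteq> {}" "A \<subseteq> {m..}" "n < m"
  shows "num_reps b I A n = 0"
proof -
  have "A \<inter> {..n} = {}" using assms by fastforce
  then have "rep_tuples b I A n \<subseteq> {}"
    using rep_tuples_subset_PiE_dflt[OF assms(1,2), of A n] assms(3) by (auto simp: PiE_dflt_def)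
  then show ?thesis by (simp add: num_reps_def)
qed

lemma sum_num_reps_le:
  assumes "finite I" "\<forall>i\<in>I. b i > 0"
  shows "(\<Sum>m\<le>M. num_reps b I A m) \<le> card (A \<inter> {..M}) ^ card I"
proof -
  have "(\<Sum>m\<le>M. num_reps b I A m) = card (\<Union>m\<le>M. rep_tuples b I A m)"
    unfolding num_reps_def
    by (subst card_UN_disjoint) (auto simp: finite_rep_tuples assms, auto simp: rep_tuples_def)
  also have "\<dots> \<le> card (PiE_dflt I 0 (\<lambda>_. A \<inter> {..M}))"
  proof (intro card_mono)
    have "rep_tuples b I A m \<subseteq> PiE_dflt I 0 (\<lambda>_. A \<inter> {..M})" if "m \<le> M" for m
      using rep_tuples_subset_PiE_dflt[OF assms, of A m] that by (fastforce simp: PiE_dflt_def)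
    then show "(\<Union>m\<le>M. rep_tuples b I A m) \<subseteq> PiE_dflt I 0 (\<lambda>_. A \<inter> {..M})" by blast
  qed (use assms in auto)
  also have "\<dots> = card (A \<inter> {..M}) ^ card I" using assms by (simp add: card_PiE_dflt)
  finally show ?thesis .
qed

lemma predictable_num_top_reps: "predictable (num_top_reps b I S n)"
  by (simp add: predictable_def num_top_reps_def Int_assoc)

lemma num_top_reps_mono:
  assumes "finite I" "\<forall>i\<in>I. b i > 0" "A \<subseteq> B"
  shows "num_top_reps b I S n k A \<le> num_top_reps b I S n k B"
  unfolding num_top_reps_def using assms by (auto intro!: num_reps_mono)

lemma num_top_reps_le_num_reps:
  assumes "finite I" "\<forall>i\<in>I. b i > 0"
  shows "num_top_reps b I S n k A \<le> num_reps b (I - S) A (n - sum b S * k)"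
  unfolding num_top_reps_def using assms by (auto intro!: num_reps_mono)

lemma argmax_eq_and_Max_eq_iff:
  fixes \<kappa> :: "'i \<Rightarrow> 'a :: linorder"
  assumes "finite I" "S \<subseteq> I" "S \<noteq> {}"
  shows "{i\<in>I. \<kappa> i = Max (\<kappa> ` I)} = S \<and> Max (\<kappa> ` I) = k \<longleftrightarrow> (\<forall>i\<in>S. \<kappa> i = k) \<and> (\<forall>i\<in>I - S. \<kappa> i < k)"
proof
  assume "{i\<in>I. \<kappa> i = Max (\<kappa> ` I)} = S \<and> Max (\<kappa> ` I) = k"
  then have S_eq: "S = {i\<in>I. \<kappa> i = k}" and "Max (\<kappa> ` I) = k" by auto
  then have "\<kappa> i \<le> k" if "i \<in> I" for i using Max_ge[of "\<kappa> ` I" "\<kappa> i"] assms(1) that by simp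
  then show "(\<forall>i\<in>S. \<kappa> i = k) \<and> (\<forall>i\<in>I - S. \<kappa> i < k)" by (auto simp: S_eq le_less)
next
  assume top: "(\<forall>i\<in>S. \<kappa> i = k) \<and> (\<forall>i\<in>I - S. \<kappa> i < k)"
  have "Max (\<kappa> ` I) = k"
  proof (rule Max_eqI)
    show "y \<le> k" if "y \<in> \<kappa> ` I" for y using top that by (auto simp: le_less)
    show "k \<in> \<kappa> ` I" using assms top by (metis all_not_in_conv image_eqI subsetD)
  qed (use assms in simp)
  moreover have "{i\<in>I. \<kappa> i = k} = S" using assms(2) top by auto
  ultimately show "{i\<in>I. \<kappa> i = Max (\<kappa> ` I)} = S \<and> Max (\<kappa> ` I) = k" by simp
qed

lemma card_rep_tuples_with_top:
  assumes index_set: "finite I" "S \<subseteq> I" "S \<noteq> {}" and k_in_A: "k \<in> A"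
  shows "card {\<kappa> \<in> rep_tuples b I A n. {i\<in>I. \<kappa> i = Max (\<kappa> ` I)} = S \<and> Max (\<kappa> ` I) = k}
    = num_top_reps b I S n k A"
proof -
  let ?T = "{\<kappa> \<in> rep_tuples b I A n. (\<forall>i\<in>S. \<kappa> i = k) \<and> (\<forall>i\<in>I - S. \<kappa> i < k)}"
  have sum_split: "(\<Sum>i\<in>I. b i * \<kappa> i) = (\<Sum>i\<in>I - S. b i * \<kappa> i) + sum b S * k"
    if "\<forall>i\<in>S. \<kappa> i = k" for \<kappa>
    using that index_set sum.subset_diff[of S I "\<lambda>i. b i * \<kappa> i"] by (simp add: sum_distrib_right)
  have "card ?T = num_top_reps b I S n k A"
  proof (cases "sum b S * k \<le> n")
    case True
    let ?R = "rep_tuples b (I - S) (A \<inter> {..<k}) (n - sum b S * k)"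
    have "bij_betw (\<lambda>\<kappa> i. if i \<in> S then 0 else \<kappa> i) ?T ?R"
    proof (rule bij_betwI)
      show "(\<lambda>\<kappa> i. if i \<in> S then 0 else \<kappa> i) \<in> ?T \<rightarrow> ?R"
        using sum_split by (auto simp: rep_tuples_def PiE_dflt_def intro!: sum.cong)
      show "(\<lambda>\<kappa> i. if i \<in> S then k else \<kappa> i) \<in> ?R \<rightarrow> ?T"
      proof
        fix \<kappa> assume \<kappa>_in: "\<kappa> \<in> ?R"
        let ?\<kappa> = "\<lambda>i. if i \<in> S then k else \<kappa> i"
        have "(\<Sum>i\<in>I. b i * ?\<kappa> i) = (\<Sum>i\<in>I - S. b i * ?\<kappa> i) + sum b S * k" by (rule sum_split) simp
        also have "(\<Sum>i\<in>I - S. b i * ?\<kappa> i) = n - sum b S * k"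
          using \<kappa>_in by (auto simp: rep_tuples_def intro!: sum.cong)
        finally show "?\<kappa> \<in> ?T"
          using \<kappa>_in index_set k_in_A True by (auto simp: rep_tuples_def PiE_dflt_def)
      qed
    qed (use index_set in \<open>auto simp: rep_tuples_def PiE_dflt_def fun_eq_iff\<close>)+
    then show ?thesis using True by (simp add: bij_betw_same_card num_top_reps_def num_reps_def)
  next
    case False
    then have "?T = {}" using sum_split by (fastforce simp: rep_tuples_def)
    then show ?thesis using False by (simp only: num_top_reps_def if_False card.empty)
  qed
  then show ?thesis by (simp only: argmax_eq_and_Max_eq_iff[OF index_set])
qed

lemma num_reps_eq_sum_num_top_reps:
  assumes index_set: "finite I" "I \<noteq> {}" "\<forall>i\<in>I. b i > 0"
  shows "num_reps b I A n = (\<Sum>S\<in>Pow I - {{}}. \<Sum>k\<in>A \<inter> {..n}. num_top_reps b I S n k A)"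
proof -
  let ?top = "\<lambda>\<kappa>. ({i\<in>I. \<kappa> i = Max (\<kappa> ` I)}, Max (\<kappa> ` I))"
  let ?P = "(Pow I - {{}}) \<times> (A \<inter> {..n})"
  have "?top ` rep_tuples b I A n \<subseteq> ?P"
  proof (rule image_subsetI)
    fix \<kappa> assume \<kappa>_in: "\<kappa> \<in> rep_tuples b I A n"
    have "Max (\<kappa> ` I) \<in> \<kappa> ` I" using index_set by (intro Max_in) auto
    moreover have "\<kappa> ` I \<subseteq> A \<inter> {..n}"
      using subsetD[OF rep_tuples_subset_PiE_dflt[OF index_set(1,3)] \<kappa>_in]
      by (auto simp: PiE_dflt_def)
    ultimately show "?top \<kappa> \<in> ?P" by auto
  qed
  then have "(\<Sum>y\<in>?P. card {\<kappa> \<in> rep_tuples b I A n. ?top \<kappa> = y}) = num_reps b I A n"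
    using sum.group[of "rep_tuples b I A n" ?P ?top "\<lambda>_. 1::nat"] index_set
    by (simp add: num_reps_def finite_rep_tuples)
  then show ?thesis
    using card_rep_tuples_with_top[OF index_set(1), of _ _ A b n]
    by (simp add: sum.cartesian_product' case_prod_unfold)
qed

lemma sum_num_top_reps_le_num_reps:
  assumes index_set: "finite I" "\<forall>i\<in>I. b i > 0" and S_sub: "S \<subseteq> I" "S \<noteq> {}"
  shows "(\<Sum>k\<in>A \<inter> {..n}. num_top_reps b I S n k A) \<le> num_reps b I A n"
proof -
  have "I \<noteq> {}" using S_sub by auto
  with S_sub show ?thesis
    using index_set num_reps_eq_sum_num_top_reps[OF index_set(1) _ index_set(2), of A n]
      member_le_sum[of S "Pow I - {{}}" "\<lambda>S. \<Sum>k\<in>A \<inter> {..n}. num_top_reps b I S n k A"] by auto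
qed

lemma num_top_reps_support:
  assumes index_set: "finite I" "\<forall>i\<in>I. b i > 0" and S_sub: "S \<subseteq> I" "S \<noteq> {}"
    and pos: "num_top_reps b I S n k X > 0"
  shows "k \<le> n" "n \<le> sum b I * k"
proof -
  have top_le: "sum b S * k \<le> n" and "num_reps b (I - S) (X \<inter> {..<k}) (n - sum b S * k) > 0"
    using pos by (auto simp: num_top_reps_def split: if_splits)
  then obtain \<kappa> where \<kappa>_in: "\<kappa> \<in> rep_tuples b (I - S) (X \<inter> {..<k}) (n - sum b S * k)"
    by (auto simp: num_reps_def card_gt_0_iff)
  have "finite S" using index_set S_sub finite_subset by blast
  then have "sum b S > 0" using index_set(2) S_sub by (intro sum_pos) blast+
  then have "1 * k \<le> sum b S * k" by (intro mult_le_mono1) simp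
  then show "k \<le> n" using top_le by linarith
  have "n - sum b S * k = (\<Sum>i\<in>I - S. b i * \<kappa> i)" using \<kappa>_in by (simp add: rep_tuples_def)
  also have "\<dots> \<le> (\<Sum>i\<in>I - S. b i * k)"
    using \<kappa>_in by (intro sum_mono mult_le_mono2) (fastforce simp: rep_tuples_def PiE_dflt_def)
  also have "\<dots> = sum b (I - S) * k" by (simp add: sum_distrib_right)
  finally have "n \<le> sum b (I - S) * k + sum b S * k" by simp
  also have "\<dots> = sum b I * k"
    using index_set S_sub by (simp add: sum.subset_diff[of S I] algebra_simps)
  finally show "n \<le> sum b I * k" .
qed

lemma sum_num_top_reps_le_card_power:
  assumes index_set: "finite I" "\<forall>i\<in>I. b i > 0" and S_sub: "S \<subseteq> I" "S \<noteq> {}"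
    and K_bound: "finite K" "\<And>k. k \<in> K \<Longrightarrow> n - sum b S * k \<le> M"
  shows "(\<Sum>k\<in>K. num_top_reps b I S n k A) \<le> card (A \<inter> {..M}) ^ card (I - S)"
proof -
  let ?K = "{k\<in>K. num_top_reps b I S n k A > 0}"
  have "finite S" using index_set S_sub finite_subset by blast
  then have pos: "sum b S > 0" using index_set(2) S_sub by (intro sum_pos) blast+
  have inj: "inj_on (\<lambda>k. n - sum b S * k) ?K"
  proof (rule inj_onI)
    fix k k' assume k_bounds: "k \<in> ?K" "k' \<in> ?K" and diff_eq: "n - sum b S * k = n - sum b S * k'"
    have "sum b S * k \<le> n" "sum b S * k' \<le> n"
      using k_bounds by (auto simp: num_top_reps_def split: if_splits)
    then have "sum b S * k = sum b S * k'" using diff_eq by linarith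
    then show "k = k'" using pos by simp
  qed
  have "(\<Sum>k\<in>K. num_top_reps b I S n k A) = (\<Sum>k\<in>?K. num_top_reps b I S n k A)"
    using K_bound by (intro sum.mono_neutral_right) auto
  also have "\<dots> \<le> (\<Sum>k\<in>?K. num_reps b (I - S) A (n - sum b S * k))"
    using index_set by (intro sum_mono num_top_reps_le_num_reps)
  also have "\<dots> = (\<Sum>m\<in>(\<lambda>k. n - sum b S * k) ` ?K. num_reps b (I - S) A m)"
    using inj by (simp add: sum.reindex)
  also have "\<dots> \<le> (\<Sum>m\<le>M. num_reps b (I - S) A m)"
    using K_bound by (intro sum_mono2) auto
  also have "\<dots> \<le> card (A \<inter> {..M}) ^ card (I - S)" using index_set by (intro sum_num_reps_le) auto
  finally show ?thesis .
qed

subsection \<open>Residue classes\<close>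

lemma bezout_finite_family:
  fixes b :: "'i \<Rightarrow> nat"
  assumes "finite I"
  shows "\<exists>z :: 'i \<Rightarrow> int. (\<Sum>i\<in>I. int (b i) * z i) = int (Gcd (b ` I))"
  using assms
proof (induction I)
  case (insert i I)
  then obtain z where bezout: "(\<Sum>i\<in>I. int (b i) * z i) = int (Gcd (b ` I))" by blast
  obtain x y where bezout_pair:
    "x * int (b i) + y * int (Gcd (b ` I)) = gcd (int (b i)) (int (Gcd (b ` I)))"
    using bezout_int by blast
  have "(\<Sum>j\<in>insert i I. int (b j) * (if j = i then x else y * z j))
      = int (b i) * x + (\<Sum>j\<in>I. int (b j) * (y * z j))"
    using insert by (auto intro!: sum.cong)
  also have "\<dots> = int (Gcd (b ` insert i I))"
    using bezout_pair bezout
    by (simp add: mult.left_commute sum_distrib_left[symmetric] mult.commute)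
  finally show ?case by (rule exI[where x="\<lambda>j. if j = i then x else y * z j"])
qed simp

lemma ex_residues_solving_congruence:
  assumes index_set: "finite I" "i \<in> I" and "b i > (0::nat)" and Gcd_eq_1: "Gcd (b ` I) = 1"
  shows "\<exists>\<rho>. (\<forall>j. \<rho> j < b i) \<and>
    (\<forall>\<kappa>. (\<forall>j\<in>I - {i}. \<kappa> j mod b i = \<rho> j) \<longrightarrow> (\<Sum>j\<in>I - {i}. b j * \<kappa> j) mod b i = n mod b i)"
proof -
  obtain z where bezout: "(\<Sum>j\<in>I. int (b j) * z j) = 1"
    using bezout_finite_family[OF index_set(1), of b] Gcd_eq_1 by auto
  define \<rho> where "\<rho> j = nat (int n * z j mod int (b i))" for j
  have \<rho>_residue: "\<rho> j < b i" "int (\<rho> j) = int n * z j mod int (b i)" for j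
    using \<open>b i > 0\<close> by (auto simp: \<rho>_def nat_less_iff)
  have "(\<Sum>j\<in>I - {i}. b j * \<kappa> j) mod b i = n mod b i" if "\<forall>j\<in>I - {i}. \<kappa> j mod b i = \<rho> j" for \<kappa>
  proof -
    have "int (b i) dvd int n * z j - int (\<kappa> j)" if "j \<in> I - {i}" for j
      using that \<open>\<forall>j\<in>I - {i}. _\<close> \<rho>_residue(2)[of j] by (metis mod_eq_dvd_iff zmod_int)
    then have "int (b i) dvd
        int n * z i * int (b i) + (\<Sum>j\<in>I - {i}. int (b j) * (int n * z j - int (\<kappa> j)))"
      by (intro dvd_add dvd_sum dvd_mult) auto
    also have "\<dots> = int n * (\<Sum>j\<in>I. int (b j) * z j) - int (\<Sum>j\<in>I - {i}. b j * \<kappa> j)"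
      using index_set by (simp add: sum.remove[of I i] sum_distrib_left sum_subtractf algebra_simps)
    finally have "int n mod int (b i) = int (\<Sum>j\<in>I - {i}. b j * \<kappa> j) mod int (b i)"
      using bezout by (simp add: mod_eq_dvd_iff)
    then show ?thesis by (metis of_nat_eq_iff zmod_int)
  qed
  then show ?thesis using \<rho>_residue(1) by blast
qed

lemma prod_card_residues_le_sum_num_top_reps:
  assumes index_set: "finite I" "\<forall>i\<in>I. b i > 0" "i \<in> I"
    and Y_sub: "Y \<subseteq> {..N}" and n_gt: "sum b I * N < n"
    and \<rho>_residue: "\<And>\<kappa>. \<forall>j\<in>I - {i}. \<kappa> j mod b i = \<rho> j \<Longrightarrow> (\<Sum>j\<in>I - {i}. b j * \<kappa> j) mod b i = n mod b i"
  shows "(\<Prod>j\<in>I - {i}. card {y\<in>Y. y mod b i = \<rho> j}) \<le> (\<Sum>k\<le>n. num_top_reps b I {i} n k Y)"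
proof -
  let ?P = "PiE_dflt (I - {i}) 0 (\<lambda>j. {y\<in>Y. y mod b i = \<rho> j})"
  let ?R = "\<lambda>k. rep_tuples b (I - {i}) (Y \<inter> {..<k}) (n - b i * k)"
  let ?K = "{k\<in>{..n}. b i * k \<le> n}"
  have finite_Y: "finite Y" using Y_sub finite_subset by blast
  have "?P \<subseteq> (\<Union>k\<in>?K. ?R k)"
  proof
    fix \<kappa> assume \<kappa>_in: "\<kappa> \<in> ?P"
    define t where "t = (\<Sum>j\<in>I - {i}. b j * \<kappa> j)"
    have "t \<le> (\<Sum>j\<in>I - {i}. b j * N)"
      unfolding t_def using \<kappa>_in Y_sub by (intro sum_mono mult_le_mono2) (auto simp: PiE_dflt_def)
    then have "t + b i * N \<le> sum b I * N"
      using index_set by (simp add: sum.remove[of I i] sum_distrib_right add_mult_distrib)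
    then have t_bound: "t + b i * N < n" using n_gt by linarith
    have "t mod b i = n mod b i"
      unfolding t_def using \<kappa>_in by (intro \<rho>_residue) (auto simp: PiE_dflt_def)
    then obtain k where k_eq: "n - t = b i * k"
      using t_bound mod_eq_dvd_iff_nat[of t n "b i"] by (auto elim: dvdE)
    then have "b i * N < b i * k" using t_bound by linarith
    then have "N < k" by simp
    then have "\<kappa> \<in> ?R k"
      using \<kappa>_in Y_sub k_eq t_bound by (auto simp: rep_tuples_def PiE_dflt_def t_def)
    moreover have "b i * k \<le> n" using k_eq t_bound by linarith
    moreover have "1 * k \<le> b i * k" using index_set by (intro mult_le_mono1) (simp add: Suc_le_eq)
    then have "k \<le> n" using \<open>b i * k \<le> n\<close> by linarith
    ultimately show "\<kappa> \<in> (\<Union>k\<in>?K. ?R k)" by auto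
  qed
  then have "card ?P \<le> card (\<Union>k\<in>?K. ?R k)"
    using index_set by (intro card_mono) (auto intro: finite_rep_tuples)
  also have "\<dots> \<le> (\<Sum>k\<in>?K. card (?R k))" by (intro card_UN_le) simp
  also have "\<dots> = (\<Sum>k\<in>?K. num_top_reps b I {i} n k Y)"
    by (intro sum.cong) (auto simp: num_top_reps_def num_reps_def)
  also have "\<dots> \<le> (\<Sum>k\<le>n. num_top_reps b I {i} n k Y)" by (intro sum_mono2) auto
  finally show ?thesis using index_set finite_Y by (simp add: card_PiE_dflt)
qed

lemma card_residue_class_ge:
  fixes q s \<rho> :: nat
  assumes "\<rho> < q"
  shows "real s / real q - 2 \<le> real (card {k\<in>{s<..2 * s}. k mod q = \<rho>})"
proof -
  have "(\<lambda>j. \<rho> + j * q) ` {s div q + 1..<2 * s div q} \<subseteq> {k\<in>{s<..2 * s}. k mod q = \<rho>}"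
  proof (rule image_subsetI)
    fix j assume j_in: "j \<in> {s div q + 1..<2 * s div q}"
    have "s < (s div q + 1) * q" using assms by (simp add: dividend_less_div_times)
    also have "\<dots> \<le> j * q" using j_in by (intro mult_le_mono1) simp
    finally have "s < j * q" .
    moreover have "(j + 1) * q \<le> 2 * s div q * q" using j_in by (intro mult_le_mono1) simp
    then have "j * q + q \<le> 2 * s"
      using div_times_less_eq_dividend[of "2 * s" q] by (simp only: add_mult_distrib mult_1)
    ultimately show "\<rho> + j * q \<in> {k\<in>{s<..2 * s}. k mod q = \<rho>}" using assms by simp
  qed
  moreover have "inj_on (\<lambda>j. \<rho> + j * q) {s div q + 1..<2 * s div q}"
    using assms by (auto simp: inj_on_def)
  ultimately have "2 * s div q - (s div q + 1) \<le> card {k\<in>{s<..2 * s}. k mod q = \<rho>}"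
    using card_inj_on_le[of _ "{s div q + 1..<2 * s div q}"] by fastforce
  then have "real (2 * s div q) - real (s div q) - 1 \<le> real (card {k\<in>{s<..2 * s}. k mod q = \<rho>})"
    by linarith
  moreover have "real (2 * s) / real q < real (2 * s div q) + 1"
    by (metis floor_divide_of_nat_eq of_int_of_nat_eq real_of_int_floor_add_one_gt)
  moreover have "real (s div q) \<le> real s / real q" by (rule of_nat_div_le_of_nat)
  ultimately show ?thesis by (simp add: field_simps)
qed

subsection \<open>Doubling and power growth\<close>

lemma iterated_scaling_le:
  fixes F :: "'a :: linordered_semidom \<Rightarrow> real"
  assumes step: "\<And>x. x0 \<le> x \<Longrightarrow> F (r * x) \<le> q * F x" and "1 \<le> r" "0 \<le> q" "0 \<le> x0" "x0 \<le> x"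
  shows "F (r ^ i * x) \<le> q ^ i * F x"
proof (induction i)
  case (Suc i)
  have "1 * x \<le> r ^ i * x" using assms by (intro mult_right_mono one_le_power) auto
  then have "F (r * (r ^ i * x)) \<le> q * F (r ^ i * x)" using assms by (intro step) auto
  also have "\<dots> \<le> q * (q ^ i * F x)" using Suc assms by (intro mult_left_mono) auto
  finally show ?case by (simp add: mult.assoc)
qed simp

lemma bounded_ratio_if_doubling:
  fixes F :: "nat \<Rightarrow> real"
  assumes mono: "\<And>m n. n0 \<le> m \<Longrightarrow> m \<le> n \<Longrightarrow> F m \<le> F n"
    and doubling: "\<And>n. n0 \<le> n \<Longrightarrow> F (2 * n) \<le> B * F n" and "0 \<le> B"
    and k_bounds: "n0 \<le> k" "k \<le> n" "n \<le> E * k"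
  shows "F n \<le> B ^ E * F k"
proof -
  have "E * k \<le> 2 ^ E * k" by (simp add: less_imp_le)
  then have "n \<le> 2 ^ E * k" using k_bounds by linarith
  then have "F n \<le> F (2 ^ E * k)" using k_bounds by (intro mono) auto
  also have "\<dots> \<le> B ^ E * F k" using assms by (intro iterated_scaling_le[of n0]) auto
  finally show ?thesis .
qed

lemma power_growth:
  fixes G :: "nat \<Rightarrow> real"
  assumes mono: "\<And>m n. n0 \<le> m \<Longrightarrow> m \<le> n \<Longrightarrow> G m \<le> G n"
    and growth: "\<And>m. n0 \<le> m \<Longrightarrow> 2 * G m \<le> G (E * m)"
    and "2 \<le> E" "n0 \<le> m" "0 < m" "m \<le> n" "0 \<le> G m"
  shows "(real n / real m) powr log (real E) 2 * G m \<le> 2 * G n"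
proof -
  have "1 \<le> n div m" using assms by (simp add: div_greater_zero_iff Suc_le_eq)
  with \<open>2 \<le> E\<close> obtain j where j_bounds: "E ^ j \<le> n div m" "n div m < E ^ (j + 1)"
    by (metis ex_power_ivl1)
  have "(real n / real m) powr log (real E) 2 \<le> real (E ^ (j + 1)) powr log (real E) 2"
  proof (rule powr_mono2)
    have "n < E ^ (j + 1) * m" using j_bounds(2) \<open>0 < m\<close> by (simp add: div_less_iff_less_mult)
    then show "real n / real m \<le> real (E ^ (j + 1))"
      using \<open>0 < m\<close> by (simp add: divide_le_eq flip: of_nat_mult del: of_nat_power)
  qed (use assms in \<open>auto simp: zero_le_log_cancel_iff\<close>)
  also have "\<dots> = (real E powr log (real E) 2) powr real (j + 1)"
    using \<open>2 \<le> E\<close> by (simp only: of_nat_power powr_realpow[symmetric] powr_powr mult.commute)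
  also have "\<dots> = 2 * 2 ^ j" using \<open>2 \<le> E\<close> by (simp add: powr_add powr_realpow)
  finally have "(real n / real m) powr log (real E) 2 * G m \<le> 2 * (2 ^ j * G m)"
    using \<open>0 \<le> G m\<close> by (simp add: mult_right_mono flip: mult.assoc)
  also have "2 ^ j * G m \<le> G (E ^ j * m)"
    using iterated_scaling_le[of n0 "\<lambda>m. - G m" E 2 m j] assms by simp
  also have "E ^ j * m \<le> n" using j_bounds(1) \<open>0 < m\<close> by (simp add: less_eq_div_iff_mult_less_eq)
  then have "G (E ^ j * m) \<le> G n" using assms by (intro mono) (auto intro: order_trans[of _ m])
  finally show ?thesis by simp
qed

text \<open>Monotonicity replaces the uniform convergence theorem of Karamata.\<close>

lemma slowly_varying_bigo_powr:
  assumes slowly: "slowly_varying \<psi>" and mono: "mono_on {1..} \<psi>" and e_pos: "e > 0"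
  shows "\<psi> \<in> O[at_top](\<lambda>x. x powr e)"
proof -
  have pos: "\<psi> x > 0" if "x \<ge> 1" for x using slowly that by (auto simp: slowly_varying_def)
  have "((\<lambda>x. \<psi> (2 * x) / \<psi> x) \<longlongrightarrow> 1) at_top" using slowly by (auto simp: slowly_varying_def)
  then have "eventually (\<lambda>x. \<psi> (2 * x) / \<psi> x < 2 powr e) at_top"
    using e_pos by (intro order_tendstoD(2)) auto
  then obtain x1 where ratio_le: "\<And>x. x \<ge> x1 \<Longrightarrow> \<psi> (2 * x) / \<psi> x < 2 powr e"
    by (auto simp: eventually_at_top_linorder)
  define x0 where "x0 = max x1 1"
  have x0_ge: "x0 \<ge> 1" by (simp add: x0_def)
  have step: "\<psi> (2 * x) \<le> 2 powr e * \<psi> x" if "x \<ge> x0" for x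
    using ratio_le[of x] pos[of x] that by (simp add: x0_def divide_less_eq less_imp_le)
  have "\<psi> x \<le> 2 powr e * \<psi> x0 * x powr e" if x_ge: "x \<ge> x0" for x
  proof -
    define k where "k = nat \<lfloor>x / x0\<rfloor>"
    have k_bounds: "1 \<le> k" "real k * x0 \<le> x" "x \<le> (real k + 1) * x0"
      using x_ge
      by (auto simp: k_def x0_def le_nat_iff le_floor_iff
          pos_le_divide_eq[symmetric] pos_divide_le_eq[symmetric])
    obtain j where j_bounds: "2 ^ j \<le> k" "k < 2 ^ (j + 1)"
      using ex_power_ivl1[of 2 k] k_bounds by auto
    have "real (Suc k) \<le> real (2 ^ (j + 1))" using j_bounds(2) by (intro of_nat_mono) simp
    then have "(real k + 1) * x0 \<le> 2 ^ (j + 1) * x0" using x0_ge by (intro mult_right_mono) auto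
    then have "x \<le> 2 ^ (j + 1) * x0" using k_bounds(3) by linarith
    then have "\<psi> x \<le> \<psi> (2 ^ (j + 1) * x0)" using x_ge x0_ge by (intro mono_onD[OF mono]) auto
    also have "\<dots> \<le> (2 powr e) ^ (j + 1) * \<psi> x0"
      using step x0_ge by (intro iterated_scaling_le[of x0]) auto
    also have "(2 powr e) ^ (j + 1) = 2 powr e * (2 ^ j) powr e"
      by (simp add: powr_powr mult.commute flip: powr_realpow)
    also have "\<dots> * \<psi> x0 \<le> 2 powr e * x powr e * \<psi> x0"
    proof (intro mult_right_mono mult_left_mono powr_mono2)
      have "real (2 ^ j) * 1 \<le> real k * x0"
        using j_bounds(1) x0_ge by (intro mult_mono) (auto simp flip: of_nat_power)
      then show "2 ^ j \<le> x" using k_bounds(2) by simp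
    qed (use e_pos pos[OF x0_ge] in auto)
    finally show ?thesis by (simp add: mult_ac)
  qed
  then have "norm (\<psi> x) \<le> 2 powr e * \<psi> x0 * norm (x powr e)" if "x0 \<le> x" for x
    using that pos[of x] x0_ge by simp
  then show ?thesis by (intro bigoI eventually_mono[OF eventually_ge_at_top[of x0]])
qed

subsection \<open>Growth functions\<close>

locale growth_function =
  fixes I :: "'i set" and b :: "'i \<Rightarrow> nat" and F \<psi> :: "nat \<Rightarrow> real"
    and B :: real and \<Lambda> n0 :: nat
  assumes finite_I: "finite I" and two_le_card_I: "2 \<le> card I"
    and b_pos: "\<forall>i\<in>I. b i > 0" and Gcd_b_eq_1: "Gcd (b ` I) = 1"
    and one_le_B: "1 \<le> B" and two_le_\<Lambda>: "2 \<le> \<Lambda>"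
    and F_pos: "\<And>n. n0 \<le> n \<Longrightarrow> F n > 0"
    and F_mono: "\<And>m n. n0 \<le> m \<Longrightarrow> m \<le> n \<Longrightarrow> F m \<le> F n"
    and F_doubling: "\<And>n. n0 \<le> n \<Longrightarrow> F (2 * n) \<le> B * F n"
    and F_growth: "\<And>n. n0 \<le> n \<Longrightarrow> 2 * F n \<le> F (\<Lambda> * n)"
    and F_le: "\<And>n. n0 \<le> n \<Longrightarrow> F n \<le> B * real n"
    and F_lower: "\<And>n. n0 \<le> n \<Longrightarrow> real n * \<psi> n \<le> B * F n ^ card I"
    and F_upper: "\<And>n. n0 \<le> n \<Longrightarrow> F n ^ (card I - 1) \<le> B * (real n * \<psi> n)"
    and \<psi>_mono: "\<And>m n. n0 \<le> m \<Longrightarrow> m \<le> n \<Longrightarrow> \<psi> m \<le> \<psi> n"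
    and ln_le_\<psi>: "\<And>n. n0 \<le> n \<Longrightarrow> ln (real n) \<le> B * \<psi> n"
    and \<psi>_small: "\<And>e. e > 0 \<Longrightarrow> \<psi> \<in> O(\<lambda>n. real n powr e)"
begin

abbreviation h :: nat where "h \<equiv> card I"

definition pivot :: 'i where "pivot = (SOME i. i \<in> I)"

definition E :: nat where "E = 8 * sum b I * \<Lambda>"

definition D :: real where "D = real E + B ^ E"

definition \<delta> :: real where "\<delta> = 1 / (4 * real h)"

definition \<sigma> :: real where "\<sigma> = \<delta> * log (real E) 2 / 2"

definition Q :: real where "Q = 2 ^ h * (1 + 4 / \<delta>)"

definition C_count :: real where "C_count = 6 * D + 2"

definition c_count :: real where "c_count = 1 / (8 * real E * real (b pivot) * D)"

definition c_reps :: real where "c_reps = c_count ^ (h - 1) / D"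

text \<open>Up to this point no constant depends on \<open>K\<close>, so \<open>K\<close> can be chosen to make \<open>c_reps * \<mu> n\<close>
  exceed a large multiple of \<open>ln n\<close>.\<close>

definition L :: real where "L = 8 * Q ^ h / c_reps"

definition K :: real where "K = L * B\<^sup>2"

definition G :: "nat \<Rightarrow> real" where "G n = min (real n) (K * F n)"

definition \<mu> :: "nat \<Rightarrow> real" where "\<mu> n = G n ^ h / real n"

definition C_\<psi> :: real where
  "C_\<psi> = 2 ^ h * (3 * D * C_count ^ h * (K ^ (h - 1) * B) + 2 * Q ^ h * B)"

definition T :: real where "T = 1 + 2 * C_\<psi> * B / \<sigma>"

definition thin :: "nat \<Rightarrow> bool" where "thin n \<longleftrightarrow> G n ^ (h - 1) \<le> real n powr (1 - 2 * \<delta>)"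

definition W :: "nat \<Rightarrow> real" where "W n = (if thin n then Q ^ h else C_\<psi> * \<psi> n)"

definition window :: "nat \<Rightarrow> nat set" where "window n = {n div E<..2 * (n div E)}"

text \<open>For the lower bound it suffices to count the representations whose entry at \<open>pivot\<close> is the
  largest one and whose other entries lie in \<open>window n\<close>.\<close>

definition num_low_reps :: "nat \<Rightarrow> nat \<Rightarrow> nat set \<Rightarrow> nat" where
  "num_low_reps n k X = num_top_reps b I {pivot} n k (X \<inter> window n)"

definition thin_rate :: "nat \<Rightarrow> nat \<Rightarrow> real" where "thin_rate j n = \<delta> / 2 * ln (real n) / Q ^ j"

definition \<psi>_rate :: "nat \<Rightarrow> real" where "\<psi>_rate n = 1 / Q ^ h"

definition full_rate :: "nat \<Rightarrow> real" where "full_rate n = 2 * ln (real n) / (T * \<mu> n)"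

definition test_exponents :: "(nat \<Rightarrow> nat \<Rightarrow> nat set \<Rightarrow> real) set" where
  "test_exponents =
    {\<lambda>n k X. of_bool (n div E < k), \<lambda>n k X. - (1 / W n * real (num_low_reps n k X))} \<union>
    (\<lambda>\<rho> n k X. - of_bool (k \<in> window n \<and> k mod b pivot = \<rho>)) ` {..<b pivot} \<union>
    (\<lambda>(r, J, S) n k X. r n * real (num_top_reps b J S n k X)) `
      (({\<psi>_rate, full_rate} \<union> thin_rate ` {..h}) \<times> Pow I \<times> Pow I)"

definition sufficiently_large :: "nat \<Rightarrow> bool" where
  "sufficiently_large n \<longleftrightarrow>
    n0 + 6 * E * b pivot + card test_exponents + 32 \<le> n \<and>
    \<psi> n \<le> real n \<and> K * ln (real n) \<le> real n \<and>
    2 / c_count * ln (real n) \<le> real n powr (4 * \<delta>) \<and>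
    D * C_count ^ h \<le> real n powr (\<delta> / 2) \<and>
    K ^ (h - 1) * B * \<psi> n \<le> real n powr (3 * \<delta>) \<and>
    8 * C_\<psi> / c_reps * (\<psi> n * ln (real n)) \<le> real n powr (2 * \<delta>) \<and>
    real E \<le> real n powr \<delta> \<and>
    2 * D * C_count ^ (h - 1) \<le> real n powr \<sigma>"

definition k0 :: nat where "k0 = (LEAST N. \<forall>n\<ge>N. sufficiently_large n)"

definition p :: "nat \<Rightarrow> real" where "p k = (if k0 \<le> k then G k / real k else 0)"

lemma pivot_in_I: "pivot \<in> I"
proof -
  have "I \<noteq> {}" using two_le_card_I by auto
  then show ?thesis unfolding pivot_def by (rule some_in_eq[THEN iffD2])
qed

lemma finite_index: "J \<subseteq> I \<Longrightarrow> finite J"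
  using finite_I finite_subset by blast

lemma b_pos_subset: "J \<subseteq> I \<Longrightarrow> \<forall>i\<in>J. b i > 0"
  using b_pos by blast

lemma b_pivot_range: "1 \<le> b pivot" "b pivot \<le> sum b I"
  using pivot_in_I b_pos finite_I by (auto simp: Suc_le_eq intro!: member_le_sum)

lemma E_ge: "8 * sum b I \<le> E" "\<Lambda> \<le> E" "8 \<le> E"
proof -
  have sum_b: "1 \<le> sum b I" using b_pivot_range by linarith
  have "8 * sum b I * 1 \<le> E" unfolding E_def using two_le_\<Lambda> by (intro mult_le_mono2) linarith
  then show "8 * sum b I \<le> E" by (simp only: mult_1_right)
  then show "8 \<le> E" using sum_b by linarith
  have "1 * \<Lambda> \<le> E" unfolding E_def using sum_b by (intro mult_le_mono1) linarith
  then show "\<Lambda> \<le> E" by (simp only: mult_1)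
qed

lemma D_ge: "real E \<le> D" "B ^ E \<le> D" "8 \<le> D"
  using E_ge(3) one_le_power[OF one_le_B, of E] by (auto simp: D_def)

lemma h_eq: "real h = 1 / (4 * \<delta>)"
  using two_le_card_I by (simp add: \<delta>_def)

lemma \<delta>_range: "0 < \<delta>" "\<delta> \<le> 1 / 8"
  using two_le_card_I by (auto simp: \<delta>_def field_simps)

lemma \<sigma>_pos: "0 < \<sigma>"
  using \<delta>_range E_ge by (simp add: \<sigma>_def)

lemma one_le_Q: "1 \<le> Q"
proof -
  have "1 * 1 \<le> 2 ^ h * (1 + 4 / \<delta>)" using \<delta>_range by (intro mult_mono) auto
  then show ?thesis by (simp add: Q_def)
qed

lemma one_le_C_count: "1 \<le> C_count"
  using D_ge by (simp add: C_count_def)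

lemma c_count_range: "0 < c_count" "c_count \<le> 1"
proof -
  have "1 * 1 * 1 \<le> 8 * real E * real (b pivot) * D"
    using E_ge(3) D_ge(3) b_pivot_range(1) by (intro mult_mono) auto
  then have "1 \<le> 1 / c_count" by (simp add: c_count_def)
  then show "0 < c_count" "c_count \<le> 1" by (auto simp: le_divide_eq_1)
qed

lemma c_reps_range: "0 < c_reps" "c_reps \<le> 1"
proof -
  show "0 < c_reps" using c_count_range D_ge by (simp add: c_reps_def)
  have "c_count ^ (h - 1) \<le> 1" using c_count_range by (intro power_le_one) auto
  then show "c_reps \<le> 1" using D_ge by (simp add: c_reps_def divide_le_eq)
qed

lemma one_le_L: "1 \<le> L"
proof -
  have "c_reps * 1 \<le> 1 * (8 * Q ^ h)"
    using c_reps_range one_le_power[OF one_le_Q, of h] by (intro mult_mono) auto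
  then show ?thesis using c_reps_range by (simp add: L_def le_divide_eq)
qed

lemma K_ge: "L \<le> K" "1 \<le> K"
proof -
  have "L * 1 \<le> L * B\<^sup>2" using one_le_L one_le_B by (intro mult_left_mono one_le_power) auto
  then show "L \<le> K" by (simp add: K_def)
  then show "1 \<le> K" using one_le_L by linarith
qed

lemma C_\<psi>_ge: "2 * Q ^ h * B \<le> C_\<psi>" "0 < C_\<psi>"
proof -
  have pos: "0 < 2 * Q ^ h * B" using one_le_Q one_le_B by simp
  moreover have "0 \<le> 3 * D * C_count ^ h * (K ^ (h - 1) * B)"
    using D_ge one_le_C_count K_ge one_le_B by simp
  ultimately have "1 * (2 * Q ^ h * B) \<le> C_\<psi>"
    unfolding C_\<psi>_def by (intro mult_mono) auto
  then show "2 * Q ^ h * B \<le> C_\<psi>" by simp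
  with pos show "0 < C_\<psi>" by (rule less_le_trans)
qed

lemma T_ge: "1 \<le> T" "2 * C_\<psi> * B \<le> \<sigma> * T"
proof -
  have "0 \<le> 2 * C_\<psi> * B / \<sigma>" using less_imp_le[OF C_\<psi>_ge(2)] one_le_B \<sigma>_pos
    by (intro divide_nonneg_pos mult_nonneg_nonneg) auto
  then show "1 \<le> T" by (simp add: T_def)
  show "2 * C_\<psi> * B \<le> \<sigma> * T" using \<sigma>_pos by (simp add: T_def distrib_left)
qed

lemma finite_test_exponents: "finite test_exponents"
  unfolding test_exponents_def using finite_I by auto

lemma predictable_test_exponents:
  assumes "u \<in> test_exponents"
  shows "predictable (u n)"
proof -
  have "num_top_reps b J S n k (X \<inter> {..<k}) = num_top_reps b J S n k X" for J S k X
    using predictable_num_top_reps[of b J S n] by (simp add: predictable_def)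
  moreover from this have "num_low_reps n k (X \<inter> {..<k}) = num_low_reps n k X" for k X
    unfolding num_low_reps_def by (metis Int_assoc Int_commute)
  ultimately show ?thesis using assms unfolding test_exponents_def predictable_def by auto
qed

lemma eventually_sufficiently_large: "eventually sufficiently_large sequentially"
proof -
  have \<psi>_le: "eventually (\<lambda>n. c * \<psi> n \<le> real n powr e) sequentially" if "e > 0" for c e
  proof -
    have "(\<lambda>n. c * \<psi> n) \<in> O(\<lambda>n. real n powr (e / 2))"
      using that \<psi>_small[of "e / 2"] by (cases "c = 0") auto
    moreover have "(\<lambda>n. real n powr (e / 2)) \<in> o(\<lambda>n. real n powr e)" using that by real_asymp
    ultimately have "(\<lambda>n. c * \<psi> n) \<in> o(\<lambda>n. real n powr e)" by (rule landau_o.big_small_trans)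
    from landau_o.smallD[OF this zero_less_one] show ?thesis by eventually_elim simp
  qed
  have \<psi>_ln_le: "eventually (\<lambda>n. c * (\<psi> n * ln (real n)) \<le> real n powr e) sequentially"
    if "e > 0" for c e
  proof -
    have "(\<lambda>n. c * ln (real n)) \<in> o(\<lambda>n. real n powr (e / 2))" using that by real_asymp
    then have "(\<lambda>n. \<psi> n * (c * ln (real n))) \<in> o(\<lambda>n. real n powr (e / 2) * real n powr (e / 2))"
      using that by (intro landau_o.big_small_mult \<psi>_small) auto
    from landau_o.smallD[OF this zero_less_one] show ?thesis
      by eventually_elim (simp add: mult_ac flip: powr_add)
  qed
  have ln_le: "eventually (\<lambda>n. c * ln (real n) \<le> real n powr e) sequentially" if "e > 0" for c e
    using that by real_asymp
  have const_le: "eventually (\<lambda>n. c \<le> real n powr e) sequentially" if "e > 0" for c e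
    using that by real_asymp
  show ?thesis
    unfolding sufficiently_large_def
  proof (intro eventually_conj)
    show "eventually (\<lambda>n. \<psi> n \<le> real n) sequentially" using \<psi>_le[of 1 1] by simp
    show "eventually (\<lambda>n. K * ln (real n) \<le> real n) sequentially" using ln_le[of 1 K] by simp
  qed (intro eventually_ge_at_top \<psi>_le \<psi>_ln_le ln_le const_le; use \<delta>_range \<sigma>_pos in simp)+
qed

lemma sufficiently_large: "k0 \<le> n \<Longrightarrow> sufficiently_large n"
  using eventually_sufficiently_large LeastI_ex[of "\<lambda>N. \<forall>n\<ge>N. sufficiently_large n"]
  unfolding k0_def eventually_sequentially by blast

lemma k0_ge: "n0 \<le> k0" "6 * E * b pivot \<le> k0" "card test_exponents + 2 \<le> k0" "32 \<le> k0"
  using sufficiently_large[OF order_refl] by (simp_all add: sufficiently_large_def)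

lemma ge_k0D:
  assumes "k0 \<le> n"
  shows "n0 \<le> n" "1 < real n" "1 \<le> ln (real n)"
proof -
  show "n0 \<le> n" "1 < real n" using assms k0_ge by auto
  have "exp 1 \<le> real n" using assms k0_ge exp_le by linarith
  then show "1 \<le> ln (real n)" using \<open>1 < real n\<close> by (simp add: ln_ge_iff)
qed

lemma \<psi>_pos: "k0 \<le> n \<Longrightarrow> 0 < \<psi> n"
  using ln_le_\<psi>[of n] ge_k0D[of n] one_le_B by (smt (verit) mult_nonneg_nonpos)

lemma le_G_power:
  assumes "1 \<le> n" "X \<le> (real n)\<^sup>2" "X \<le> (K * F n) ^ h"
  shows "X \<le> G n ^ h"
proof -
  have "(real n)\<^sup>2 \<le> real n ^ h" using assms two_le_card_I by (intro power_increasing) auto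
  then show ?thesis using assms by (auto simp: G_def min_def)
qed

lemma F_power_le:
  assumes "n0 \<le> n"
  shows "F n ^ h \<le> (K * F n) ^ h"
  using F_pos[OF assms] K_ge(2) by (intro power_mono) (auto simp: mult_le_cancel_right1)

lemma G_lower:
  assumes n_ge: "k0 \<le> n"
  shows "real n * \<psi> n \<le> B * G n ^ h"
proof -
  note large = ge_k0D[OF n_ge]
  have "real n * \<psi> n / B \<le> G n ^ h"
  proof (rule le_G_power)
    have "real n * \<psi> n / B \<le> real n * \<psi> n / 1"
      using one_le_B \<psi>_pos[OF n_ge] by (intro divide_left_mono) auto
    also have "\<dots> \<le> real n * real n"
      using sufficiently_large[OF n_ge]
      by (auto simp: sufficiently_large_def intro!: mult_left_mono)
    finally show "real n * \<psi> n / B \<le> (real n)\<^sup>2" by (simp add: power2_eq_square)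
    have "real n * \<psi> n / B \<le> F n ^ h"
      using F_lower[OF large(1)] one_le_B by (simp add: divide_le_eq mult.commute)
    also have "\<dots> \<le> (K * F n) ^ h" by (rule F_power_le[OF large(1)])
    finally show "real n * \<psi> n / B \<le> (K * F n) ^ h" .
  qed (use large in auto)
  then show ?thesis using one_le_B by (simp add: divide_le_eq mult.commute)
qed

lemma G_lower_ln:
  assumes n_ge: "k0 \<le> n"
  shows "L * (real n * ln (real n)) \<le> G n ^ h"
proof (rule le_G_power)
  note large = ge_k0D[OF n_ge]
  show "1 \<le> n" using large(2) by simp
  have "L * (real n * ln (real n)) \<le> K * (real n * ln (real n))"
    using K_ge(1) large by (intro mult_right_mono) auto
  also have "\<dots> = real n * (K * ln (real n))" by simp
  also have "\<dots> \<le> real n * real n"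
    using sufficiently_large[OF n_ge] by (intro mult_left_mono) (auto simp: sufficiently_large_def)
  finally show "L * (real n * ln (real n)) \<le> (real n)\<^sup>2" by (simp add: power2_eq_square)
  have "L * (real n * ln (real n)) \<le> L * (real n * (B * \<psi> n))"
    using one_le_L ln_le_\<psi>[OF large(1)] by (intro mult_left_mono) auto
  also have "\<dots> = L * B * (real n * \<psi> n)" by simp
  also have "\<dots> \<le> L * B * (B * F n ^ h)"
    using one_le_L one_le_B F_lower[OF large(1)] by (intro mult_left_mono) auto
  also have "\<dots> = K ^ 1 * F n ^ h" by (simp add: K_def power2_eq_square)
  also have "\<dots> \<le> K ^ h * F n ^ h"
    using K_ge(2) two_le_card_I F_pos[OF large(1)] by (intro mult_right_mono power_increasing) auto
  finally show "L * (real n * ln (real n)) \<le> (K * F n) ^ h" by (simp add: power_mult_distrib)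
qed

lemma G_mono:
  assumes "n0 \<le> m" "m \<le> n"
  shows "G m \<le> G n"
  unfolding G_def using assms K_ge F_mono by (intro min.mono mult_left_mono) auto

lemma G_doubling:
  assumes "n0 \<le> k" "k \<le> n" "n \<le> E * k"
  shows "G n \<le> D * G k"
proof -
  have "F n \<le> B ^ E * F k"
    using F_mono F_doubling one_le_B assms by (intro bounded_ratio_if_doubling[of n0]) auto
  also have "\<dots> \<le> D * F k" using D_ge F_pos[OF assms(1)] by (intro mult_right_mono) auto
  finally have "K * F n \<le> D * (K * F k)" using K_ge by (simp add: mult.left_commute mult_left_mono)
  moreover have "real n \<le> D * real k"
  proof -
    have "real n \<le> real E * real k" using assms(3) by (simp flip: of_nat_mult)
    also have "\<dots> \<le> D * real k" using D_ge by (intro mult_right_mono) auto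
    finally show ?thesis .
  qed
  ultimately show ?thesis using D_ge by (auto simp: G_def min_def)
qed

lemma G_growth:
  assumes "n0 \<le> m" "E * m \<le> n"
  shows "2 * G m \<le> G n"
proof -
  have "\<Lambda> * m \<le> E * m" "2 * m \<le> E * m" using E_ge by (intro mult_le_mono1; linarith)+
  moreover have "1 * m \<le> \<Lambda> * m" using two_le_\<Lambda> by (intro mult_le_mono1) linarith
  ultimately have "n0 \<le> \<Lambda> * m" "\<Lambda> * m \<le> n" "2 * m \<le> n" using assms by linarith+
  then have "F (\<Lambda> * m) \<le> F n" "2 * real m \<le> real n" using F_mono by (auto dest: of_nat_mono)
  with F_growth[OF assms(1)] have "K * (2 * F m) \<le> K * F n"
    using K_ge by (intro mult_left_mono) auto
  with \<open>2 * real m \<le> real n\<close> show ?thesis by (auto simp: G_def min_def)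
qed

lemma G_upper:
  assumes n_ge: "k0 \<le> n"
  shows "G n ^ (h - 1) \<le> K ^ (h - 1) * B * (real n * \<psi> n)"
proof -
  have "G n ^ (h - 1) \<le> (K * F n) ^ (h - 1)"
    using F_pos[of n] K_ge ge_k0D[OF n_ge] by (intro power_mono) (auto simp: G_def)
  also have "\<dots> = K ^ (h - 1) * F n ^ (h - 1)" by (rule power_mult_distrib)
  also have "\<dots> \<le> K ^ (h - 1) * (B * (real n * \<psi> n))"
    using K_ge F_upper[of n] ge_k0D[OF n_ge] by (intro mult_left_mono) auto
  finally show ?thesis by (simp add: mult.assoc)
qed

lemma \<psi>_le_\<mu>: "k0 \<le> n \<Longrightarrow> \<psi> n \<le> B * \<mu> n"
  using G_lower[of n] ge_k0D[of n] by (simp add: \<mu>_def le_divide_eq mult_ac)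

lemma Q_ln_le_\<mu>: "k0 \<le> n \<Longrightarrow> 8 * Q ^ h * ln (real n) \<le> c_reps * \<mu> n"
  using G_lower_ln[of n] ge_k0D[of n] c_reps_range by (simp add: \<mu>_def L_def field_simps)

lemma \<mu>_ge_1:
  assumes "k0 \<le> n"
  shows "1 \<le> \<mu> n"
proof -
  have "1 \<le> 8 * Q ^ h" using one_le_power[OF one_le_Q, of h] by linarith
  then have "1 * 1 \<le> 8 * Q ^ h * ln (real n)" using ge_k0D[OF assms] by (intro mult_mono) auto
  also have "\<dots> \<le> c_reps * \<mu> n" by (rule Q_ln_le_\<mu>[OF assms])
  finally have "1 \<le> c_reps * \<mu> n" by simp
  then show ?thesis using c_reps_range by (smt (verit) mult_left_le_one_le mult_nonneg_nonpos)
qed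

lemma G_root:
  assumes n_ge: "k0 \<le> n"
  shows "real n powr (4 * \<delta>) \<le> G n"
proof (rule power_le_imp_le_base)
  show "0 \<le> G n" using F_pos[of n] K_ge ge_k0D[OF n_ge] by (simp add: G_def)
  have "(real n powr (4 * \<delta>)) ^ Suc (h - 1) = (real n powr (4 * \<delta>)) powr real h"
    using ge_k0D[OF n_ge] two_le_card_I by (subst powr_realpow) auto
  also have "\<dots> = real n * 1" using ge_k0D[OF n_ge] \<delta>_range by (simp add: powr_powr h_eq)
  also have "\<dots> \<le> real n * \<mu> n" using \<mu>_ge_1[OF n_ge] by (intro mult_left_mono) auto
  also have "real n * \<mu> n = G n ^ h" using ge_k0D[OF n_ge] by (simp add: \<mu>_def)
  finally show "(real n powr (4 * \<delta>)) ^ Suc (h - 1) \<le> G n ^ Suc (h - 1)" using two_le_card_I by simp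
qed

lemma G_ge_1:
  assumes n_ge: "k0 \<le> n"
  shows "1 \<le> G n"
proof -
  have "1 \<le> real n powr (4 * \<delta>)" using ge_k0D[OF n_ge] \<delta>_range by (intro ge_one_powr_ge_zero) auto
  then show ?thesis using G_root[OF n_ge] by linarith
qed

lemma ln_le_G:
  assumes n_ge: "k0 \<le> n"
  shows "2 * ln (real n) \<le> c_count * G n"
proof -
  have "2 / c_count * ln (real n) \<le> G n"
    using G_root[OF n_ge] sufficiently_large[OF n_ge] by (simp add: sufficiently_large_def)
  then show ?thesis using c_count_range by (simp add: field_simps)
qed

lemma G_power_times_root_le:
  assumes n_ge: "k0 \<le> n"
  shows "G n ^ (h - 1) * real n powr (4 * \<delta>) \<le> real n * \<mu> n"
proof -
  have "G n ^ (h - 1) * real n powr (4 * \<delta>) \<le> G n ^ (h - 1) * G n"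
    using G_root[OF n_ge] G_ge_1[OF n_ge] by (intro mult_left_mono) auto
  also have "\<dots> = G n ^ Suc (h - 1)" by simp
  also have "\<dots> = real n * \<mu> n" using two_le_card_I ge_k0D[OF n_ge] by (simp add: \<mu>_def)
  finally show ?thesis .
qed

lemma \<mu>_ge_if_not_thin:
  assumes n_ge: "k0 \<le> n" and "\<not> thin n"
  shows "real n powr (2 * \<delta>) \<le> \<mu> n"
proof -
  have "real n powr (2 * \<delta>) * real n = real n powr (1 - 2 * \<delta>) * real n powr (4 * \<delta>)"
    using ge_k0D[OF n_ge] by (simp add: powr_mult_base mult.commute add.commute flip: powr_add)
  also have "\<dots> \<le> G n ^ (h - 1) * real n powr (4 * \<delta>)"
    using \<open>\<not> thin n\<close> by (intro mult_right_mono) (auto simp: thin_def)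
  also have "\<dots> \<le> real n * \<mu> n" by (rule G_power_times_root_le[OF n_ge])
  finally show ?thesis using ge_k0D[OF n_ge] by (simp add: mult.commute)
qed

lemma G_power_h_minus_2_le:
  assumes n_ge: "k0 \<le> n"
  shows "G n ^ (h - 2) \<le> real n powr (1 - \<delta>)"
proof -
  have "G n ^ (h - 2) * real n powr (4 * \<delta>) \<le> G n ^ (h - 2) * G n"
    using G_root[OF n_ge] G_ge_1[OF n_ge] by (intro mult_left_mono) auto
  also have "\<dots> = G n ^ Suc (h - 2)" by simp
  also have "Suc (h - 2) = h - 1" using two_le_card_I by simp
  also have "G n ^ (h - 1) \<le> K ^ (h - 1) * B * (real n * \<psi> n)" by (rule G_upper[OF n_ge])
  also have "\<dots> = K ^ (h - 1) * B * \<psi> n * real n" by simp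
  also have "\<dots> \<le> real n powr (3 * \<delta>) * real n"
    using sufficiently_large[OF n_ge] by (intro mult_right_mono) (auto simp: sufficiently_large_def)
  also have "\<dots> = real n powr (1 - \<delta>) * real n powr (4 * \<delta>)"
    using ge_k0D[OF n_ge] by (simp add: powr_mult_base mult.commute add.commute flip: powr_add)
  finally show ?thesis using ge_k0D[OF n_ge] by simp
qed

lemma G_power_le_if_card_le:
  assumes "k0 \<le> n" "j \<le> h - 2"
  shows "G n ^ j \<le> real n powr (1 - \<delta>)"
  using power_increasing[OF assms(2) G_ge_1[OF assms(1)]] G_power_h_minus_2_le[OF assms(1)]
  by linarith

lemma G_le_if_le_powr:
  assumes m_ge: "k0 \<le> m" "m \<le> n" "real m \<le> real n powr (1 - \<delta>)"
  shows "G m \<le> 2 * real n powr (- 2 * \<sigma>) * G n"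
proof -
  have mn_pos: "0 < real m" "0 < real n" using ge_k0D[of m] m_ge by auto
  have "real n powr (2 * \<sigma>) = (real n powr \<delta>) powr log (real E) 2" by (simp add: \<sigma>_def powr_powr)
  also have "\<dots> \<le> (real n / real m) powr log (real E) 2"
  proof (rule powr_mono2)
    have "real n powr \<delta> * real m \<le> real n powr \<delta> * real n powr (1 - \<delta>)"
      using m_ge by (intro mult_left_mono) auto
    also have "\<dots> = real n" using mn_pos by (simp flip: powr_add)
    finally show "real n powr \<delta> \<le> real n / real m" using mn_pos by (simp add: le_divide_eq)
  qed (use E_ge in auto)
  finally have "real n powr (2 * \<sigma>) * G m \<le> (real n / real m) powr log (real E) 2 * G m"
    using G_ge_1[OF m_ge(1)] by (intro mult_right_mono) auto
  also have "\<dots> \<le> 2 * G n"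
    using G_mono G_growth E_ge G_ge_1[OF m_ge(1)] ge_k0D[of m] m_ge mn_pos
    by (intro power_growth[of n0]) auto
  finally show ?thesis using mn_pos by (simp add: powr_minus field_simps)
qed

lemma p_nonneg: "0 \<le> p k"
  using G_ge_1[of k] by (auto simp: p_def)

lemma p_le_1: "p k \<le> 1"
  using ge_k0D[of k] by (auto simp: p_def G_def)

lemma p_le:
  assumes n_ge: "k0 \<le> n" and k_bounds: "k \<le> n" "n \<le> E * k"
  shows "p k \<le> D * (G n / real n)"
proof (cases "k0 \<le> k")
  case True
  then have pos: "0 < real k" "0 < real n" "0 \<le> G n"
    using ge_k0D[of k] ge_k0D[OF n_ge] G_ge_1[OF n_ge] by auto
  have "G k / real k \<le> G n / real k"
    using G_mono[of k n] ge_k0D[OF True] k_bounds pos by (intro divide_right_mono) auto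
  also have "\<dots> \<le> D * (G n / real n)"
  proof -
    have "real n \<le> real E * real k" using k_bounds(2) by (simp flip: of_nat_mult)
    also have "\<dots> \<le> D * real k" using D_ge by (intro mult_right_mono) auto
    finally have "G n * real n \<le> G n * (D * real k)" using pos by (intro mult_left_mono) auto
    then show ?thesis using pos by (simp add: field_simps)
  qed
  finally show ?thesis using True by (simp add: p_def)
next
  case False
  then show ?thesis using G_ge_1[OF n_ge] D_ge by (simp add: p_def)
qed

lemma p_ge:
  assumes k_bounds: "k0 \<le> k" "k \<le> n" "n \<le> E * k"
  shows "G n / (D * real n) \<le> p k"
proof -
  have pos: "0 < real k" "0 < real n" "0 < D" "0 \<le> G k"
    using ge_k0D[of k] G_ge_1[of k] k_bounds D_ge by auto
  have "G n / (D * real n) \<le> D * G k / (D * real n)"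
    using G_doubling[of k n] ge_k0D[of k] k_bounds pos by (intro divide_right_mono) auto
  also have "\<dots> = G k / real n" using pos by simp
  also have "\<dots> \<le> G k / real k" using pos k_bounds by (intro divide_left_mono) auto
  finally show ?thesis using k_bounds by (simp add: p_def)
qed

lemma thin_imp_G_power_le:
  assumes n_ge: "k0 \<le> n" "thin n" and m_ge: "k0 \<le> m" "m \<le> n" "real n powr (1 - \<delta>) \<le> real m"
    and j_bounds: "j \<le> h - 1"
  shows "G m ^ j \<le> real m powr (1 - \<delta>)"
proof -
  have "G m ^ j \<le> G m ^ (h - 1)" using G_ge_1[OF m_ge(1)] j_bounds by (intro power_increasing)
  also have "\<dots> \<le> G n ^ (h - 1)"
    using G_mono[of m n] G_ge_1[OF m_ge(1)] ge_k0D[OF m_ge(1)] m_ge by (intro power_mono) auto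
  also have "\<dots> \<le> real n powr (1 - 2 * \<delta>)" using n_ge by (simp add: thin_def)
  also have "\<dots> \<le> real n powr ((1 - \<delta>) * (1 - \<delta>))"
    using ge_k0D[OF n_ge(1)] by (intro powr_mono) (auto simp: algebra_simps)
  also have "\<dots> = (real n powr (1 - \<delta>)) powr (1 - \<delta>)" by (simp add: powr_powr)
  also have "\<dots> \<le> real m powr (1 - \<delta>)" using m_ge \<delta>_range by (intro powr_mono2) auto
  finally show ?thesis .
qed

lemma Q_power_le_C_\<psi>:
  assumes n_ge: "k0 \<le> n"
  shows "Q ^ h \<le> C_\<psi> * \<psi> n"
proof -
  have "1 \<le> B * \<psi> n" using ln_le_\<psi>[of n] ge_k0D[OF n_ge] by linarith
  then have "Q ^ h * 1 \<le> 2 * Q ^ h * (B * \<psi> n)" using one_le_Q by (intro mult_mono) auto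
  also have "\<dots> \<le> C_\<psi> * \<psi> n"
    using mult_right_mono[OF C_\<psi>_ge(1), of "\<psi> n"] \<psi>_pos[OF n_ge] by (simp add: mult.assoc)
  finally show ?thesis by simp
qed

lemma Q_power_le_W: "k0 \<le> n \<Longrightarrow> Q ^ h \<le> W n"
  using Q_power_le_C_\<psi> by (simp add: W_def)

lemma W_pos: "k0 \<le> n \<Longrightarrow> 0 < W n"
  using Q_power_le_W[of n] one_le_Q zero_less_power[of Q h] by linarith

lemma W_ln_le:
  assumes n_ge: "k0 \<le> n"
  shows "8 * W n * ln (real n) \<le> c_reps * \<mu> n"
proof (cases "thin n")
  case True
  then show ?thesis using Q_ln_le_\<mu>[OF n_ge] by (simp add: W_def)
next
  case False
  have "8 * C_\<psi> / c_reps * (\<psi> n * ln (real n)) \<le> real n powr (2 * \<delta>)"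
    using sufficiently_large[OF n_ge] by (simp add: sufficiently_large_def)
  also have "\<dots> \<le> \<mu> n" using \<mu>_ge_if_not_thin[OF n_ge False] .
  finally show ?thesis using c_reps_range False by (simp add: W_def field_simps)
qed

end

subsection \<open>Sets satisfying the exponential moment bounds\<close>

locale concentrated_set = growth_function +
  fixes A :: "nat set"
  assumes A_ge: "A \<subseteq> {k0..}"
    and test_exponent_le: "\<And>u n N. u \<in> test_exponents \<Longrightarrow> k0 \<le> n \<Longrightarrow>
      compensated_sum p (u n) A N \<le> 2 * ln (real n)"
begin

lemma A_atMost_eq_empty: "n < k0 \<Longrightarrow> A \<inter> {..n} = {}"
  using A_ge by auto

lemma card_A_interval_le:
  assumes n_ge: "k0 \<le> n"
  shows "real (card (A \<inter> {n div E<..n})) \<le> (3 * D + 1) * G n"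
proof -
  let ?w = "\<lambda>k. of_bool (n div E < k) :: real"
  have G_pos: "0 \<le> G n" "0 < real n" using G_ge_1[OF n_ge] ge_k0D[OF n_ge] by auto
  have "real (card (A \<inter> {n div E<..n})) = (\<Sum>k\<in>A \<inter> {..n}. ?w k)"
    by (simp add: of_bool_def sum.If_cases Int_def greaterThanAtMost_def conj_ac)
  also have "\<dots> \<le> (\<Sum>k\<le>n. p k * (?w k * exp (1 * ?w k))) + 2 * ln (real n) / 1"
    using test_exponent_le[OF _ n_ge, of "\<lambda>n k X. of_bool (n div E < k)"]
    by (intro sum_members_le[where w = "\<lambda>k X. of_bool (n div E < k)"] p_nonneg)
      (auto simp: test_exponents_def)
  also have "(\<Sum>k\<le>n. p k * (?w k * exp (1 * ?w k)))
      \<le> (\<Sum>k\<le>n. (if k = 0 then 0 else 3 * D * (G n / real n)))"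
  proof (rule sum_mono)
    fix k assume "k \<in> {..n}"
    have "p k * exp 1 \<le> D * (G n / real n) * 3" if "n div E < k"
    proof (rule mult_mono)
      have "n \<le> E * k" using that E_ge(3) by (simp add: div_less_iff_less_mult mult.commute)
      then show "p k \<le> D * (G n / real n)" using \<open>k \<in> {..n}\<close> by (intro p_le[OF n_ge]) auto
    qed (use exp_le D_ge G_pos in auto)
    then show "p k * (?w k * exp (1 * ?w k)) \<le> (if k = 0 then 0 else 3 * D * (G n / real n))"
      using D_ge G_pos by (auto simp: of_bool_def mult_ac)
  qed
  also have "\<dots> = (\<Sum>k\<in>{1..n}. 3 * D * (G n / real n))"
    by (rule sum.mono_neutral_cong_right) auto
  also have "\<dots> = 3 * D * G n" using G_pos by simp
  also have "2 * ln (real n) \<le> 1 * G n"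
    using ln_le_G[OF n_ge] c_count_range G_pos mult_right_mono[of c_count 1 "G n"] by linarith
  finally show ?thesis by (simp add: algebra_simps)
qed

lemma count_le:
  assumes "k0 \<le> n"
  shows "real (card (A \<inter> {..n})) \<le> C_count * G n"
  using assms
proof (induction n rule: less_induct)
  case (less n)
  have "real (card (A \<inter> {..n div E})) \<le> (3 * D + 1) * G n"
  proof (cases "n div E < k0")
    case True
    then show ?thesis using A_atMost_eq_empty D_ge G_ge_1[OF less.prems] by simp
  next
    case False
    have "n div E < n" using ge_k0D[OF less.prems] E_ge by (intro div_less_dividend) auto
    then have "real (card (A \<inter> {..n div E})) \<le> C_count * G (n div E)" using less.IH False by simp
    also have "\<dots> \<le> C_count * (G n / 2)"
      using G_growth[of "n div E" n] ge_k0D[of "n div E"] False one_le_C_count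
      by (intro mult_left_mono) auto
    finally show ?thesis by (simp add: C_count_def algebra_simps)
  qed
  moreover have "A \<inter> {..n} = (A \<inter> {..n div E}) \<union> (A \<inter> {n div E<..n})"
    by (auto intro: order_trans[OF _ div_le_dividend])
  then have "real (card (A \<inter> {..n}))
      \<le> real (card (A \<inter> {..n div E})) + real (card (A \<inter> {n div E<..n}))"
    using card_Un_le by (metis of_nat_add of_nat_mono)
  ultimately show ?case
    using card_A_interval_le[OF less.prems] by (simp add: C_count_def algebra_simps)
qed

lemma ge_E_k0D:
  assumes "E * k0 \<le> n"
  shows "k0 \<le> n" "k0 \<le> n div E" "2 * (n div E) \<le> n"
proof -
  have "1 * k0 \<le> E * k0" using E_ge(3) by (intro mult_le_mono1) simp
  then show "k0 \<le> n" using assms by linarith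
  show "k0 \<le> n div E" using assms E_ge(3) by (simp add: less_eq_div_iff_mult_less_eq mult.commute)
  have "2 * (n div E) \<le> E * (n div E)" using E_ge(3) by (intro mult_le_mono1) simp
  then show "2 * (n div E) \<le> n" by (rule order_trans) simp
qed

lemma card_residue_window_ge:
  assumes n_ge: "k0 \<le> n" and \<rho>_less: "\<rho> < b pivot"
  shows "real n / (2 * (real E * real (b pivot))) \<le> real (card {k\<in>window n. k mod b pivot = \<rho>})"
proof -
  let ?q = "real (b pivot)"
  have q_pos: "1 \<le> ?q" "0 < real E" using b_pivot_range E_ge(3) by auto
  have "real n / real E \<le> real (n div E) + 1"
    by (metis floor_divide_of_nat_eq of_int_of_nat_eq real_of_int_floor_add_one_ge)
  then have "real n / real E / ?q \<le> (real (n div E) + 1) / ?q"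
    using q_pos by (intro divide_right_mono) auto
  moreover have "1 / ?q \<le> 1" using q_pos by simp
  ultimately have "real n / (real E * ?q) - 3 \<le> real (n div E) / ?q - 2"
    by (simp add: add_divide_distrib)
  also have "\<dots> \<le> real (card {k\<in>window n. k mod b pivot = \<rho>})"
    using card_residue_class_ge[OF \<rho>_less] unfolding window_def .
  also have "real n / (2 * (real E * ?q)) \<le> real n / (real E * ?q) - 3"
  proof -
    have "real (6 * E * b pivot) \<le> real n" using n_ge k0_ge(2) by (intro of_nat_mono) linarith
    then show ?thesis using q_pos by (simp add: field_simps)
  qed
  finally show ?thesis .
qed

lemma count_residue_ge:
  assumes n_ge: "E * k0 \<le> n" and \<rho>_less: "\<rho> < b pivot"
  shows "c_count * G n \<le> real (card {k \<in> A \<inter> window n. k mod b pivot = \<rho>})"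
proof -
  note large = ge_E_k0D[OF n_ge]
  let ?R = "{k\<in>window n. k mod b pivot = \<rho>}"
  let ?w = "\<lambda>k. of_bool (k \<in> ?R) :: real"
  have R_sub: "?R \<subseteq> {..n}" using large by (auto simp: window_def)
  have pos: "0 < real n" "0 < D" "0 \<le> G n / (D * real n)"
    using ge_k0D[OF large(1)] D_ge G_ge_1[OF large(1)] by auto
  have "4 * (c_count * G n) = real n / (2 * (real E * real (b pivot))) * (G n / (D * real n))"
    using pos by (simp add: c_count_def)
  also have "\<dots> \<le> real (card ?R) * (G n / (D * real n))"
    using card_residue_window_ge[OF large(1) \<rho>_less] pos by (intro mult_right_mono)
  also have "\<dots> = (\<Sum>k\<in>?R. G n / (D * real n))" by simp
  also have "\<dots> \<le> (\<Sum>k\<in>?R. p k)"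
  proof (rule sum_mono)
    fix k assume k_in: "k \<in> ?R"
    then have "n \<le> E * k"
      using E_ge(3) by (auto simp: window_def div_less_iff_less_mult mult.commute)
    then show "G n / (D * real n) \<le> p k"
      using k_in R_sub large by (intro p_ge) (auto simp: window_def)
  qed
  also have "\<dots> = (\<Sum>k\<le>n. p k * ?w k)"
    using R_sub by (simp add: of_bool_def if_distrib sum.If_cases Int_absorb1 cong: if_cong)
  finally have "2 * (c_count * G n) - 2 * ln (real n) / 1
      \<le> (\<Sum>k\<le>n. p k * ?w k) / 2 - 2 * ln (real n) / 1"
    by simp
  also have "\<dots> \<le> (\<Sum>k\<in>A \<inter> {..n}. ?w k)"
    using test_exponent_le[OF _ large(1), of "\<lambda>n k X. - of_bool (k \<in> window n \<and> k mod b pivot = \<rho>)"]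
      \<rho>_less
    by (intro sum_members_ge[where w = "\<lambda>k X. of_bool (k \<in> ?R)"] p_nonneg)
      (auto simp: test_exponents_def)
  also have "\<dots> = real (card {k \<in> A \<inter> window n. k mod b pivot = \<rho>})"
    using R_sub by (auto simp: of_bool_def sum.If_cases intro!: arg_cong[of _ _ card])
  finally show ?thesis using ln_le_G[OF large(1)] by simp
qed

lemma count_ge:
  assumes n_ge: "E * k0 \<le> n"
  shows "c_count * G n \<le> real (card (A \<inter> {..n}))"
proof -
  have "c_count * G n \<le> real (card {k \<in> A \<inter> window n. k mod b pivot = 0})"
    using count_residue_ge[OF n_ge, of 0] b_pivot_range by simp
  also have "\<dots> \<le> real (card (A \<inter> {..n}))"
    using ge_E_k0D[OF n_ge] by (intro of_nat_mono card_mono) (auto simp: window_def)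
  finally show ?thesis .
qed

subsection \<open>Upper bounds for the number of representations\<close>

lemma sum_num_top_reps_chernoff:
  assumes n_ge: "k0 \<le> n" and "S \<subseteq> J" "J \<subseteq> I"
    and rate: "r \<in> {\<psi>_rate, full_rate} \<union> thin_rate ` {..h}" "0 < r n"
  shows "(\<Sum>k\<in>A \<inter> {..n}. real (num_top_reps b J S n k A)) \<le>
    (\<Sum>k\<le>n. p k * (real (num_top_reps b J S n k A) * exp (r n * real (num_top_reps b J S n k A))))
      + 2 * ln (real n) / r n"
proof (rule sum_members_le[OF p_nonneg \<open>0 < r n\<close>])
  have "(\<lambda>n k X. r n * real (num_top_reps b J S n k X)) \<in> test_exponents"
    unfolding test_exponents_def using assms by (intro UnI2 image_eqI[of _ _ "(r, J, S)"]) auto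
  from test_exponent_le[OF this n_ge]
  show "compensated_sum p (\<lambda>k X. r n * real (num_top_reps b J S n k X)) A (Suc n)
      \<le> 2 * ln (real n)" .
qed

lemma sum_num_top_reps_chernoff_bounded:
  assumes n_ge: "k0 \<le> n" and "S \<subseteq> J" "J \<subseteq> I"
    and rate: "r \<in> {\<psi>_rate, full_rate} \<union> thin_rate ` {..h}" "0 < r n"
    and bound: "\<And>k. r n * real (num_top_reps b J S n k A) \<le> c"
  shows "(\<Sum>k\<in>A \<inter> {..n}. real (num_top_reps b J S n k A)) \<le>
    exp c * (\<Sum>k\<le>n. p k * real (num_top_reps b J S n k A)) + 2 * ln (real n) / r n"
proof -
  let ?w = "\<lambda>k. real (num_top_reps b J S n k A)"
  have "(\<Sum>k\<le>n. p k * (?w k * exp (r n * ?w k))) \<le> (\<Sum>k\<le>n. p k * (?w k * exp c))"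
    using bound p_nonneg by (intro sum_mono mult_left_mono) auto
  also have "\<dots> = exp c * (\<Sum>k\<le>n. p k * ?w k)" by (simp add: sum_distrib_left mult_ac)
  finally show ?thesis using sum_num_top_reps_chernoff[OF assms(1-5)] by linarith
qed

lemma sum_p_num_top_reps_le:
  assumes n_ge: "k0 \<le> n" and J_sub: "J \<subseteq> I" "S \<subseteq> J" "S \<noteq> {}"
    and N_bound: "finite N" "\<And>k. k \<in> N \<Longrightarrow> n - sum b S * k \<le> M"
  shows "(\<Sum>k\<in>N. p k * real (num_top_reps b J S n k A))
    \<le> D * (G n / real n) * real (card (A \<inter> {..M})) ^ card (J - S)"
proof -
  let ?w = "\<lambda>k. num_top_reps b J S n k A"
  note fin = finite_index[OF J_sub(1)] b_pos_subset[OF J_sub(1)]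
  have "p k * real (?w k) \<le> D * (G n / real n) * real (?w k)" for k
  proof (cases "?w k = 0")
    case False
    then have k_bounds: "k \<le> n" "n \<le> sum b J * k"
      using num_top_reps_support[OF fin J_sub(2,3)] by auto
    have "sum b J \<le> sum b I" using J_sub finite_I by (intro sum_mono2) auto
    also have "\<dots> \<le> E" using E_ge(1) by simp
    finally have "sum b J * k \<le> E * k" by simp
    then have "n \<le> E * k" using k_bounds by linarith
    then show ?thesis using p_le[OF n_ge k_bounds(1)] by (intro mult_right_mono) auto
  qed simp
  then have "(\<Sum>k\<in>N. p k * real (?w k)) \<le> D * (G n / real n) * real (\<Sum>k\<in>N. ?w k)"
    by (simp add: sum_distrib_left sum_mono)
  also have "\<dots> \<le> D * (G n / real n) * real (card (A \<inter> {..M}) ^ card (J - S))"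
    using sum_num_top_reps_le_card_power[OF fin J_sub(2,3) N_bound] D_ge G_ge_1[OF n_ge]
    by (intro mult_left_mono of_nat_mono) auto
  finally show ?thesis by simp
qed

lemma sum_p_num_top_reps_le_G_power:
  assumes n_ge: "k0 \<le> n" and J_sub: "J \<subseteq> I" "S \<subseteq> J" "S \<noteq> {}" and l_bounds: "card J \<le> l" "l \<le> h"
  shows "(\<Sum>k\<le>n. p k * real (num_top_reps b J S n k A)) \<le> D * C_count ^ h * (G n ^ l / real n)"
proof -
  have "card (J - S) < card J"
    using J_sub finite_index[OF J_sub(1)] by (intro psubset_card_mono) auto
  then have card_diff: "card (J - S) \<le> l - 1" "l \<ge> 1" using l_bounds by linarith+
  have ge_1: "1 \<le> C_count" "1 \<le> G n" using one_le_C_count G_ge_1[OF n_ge] by auto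
  have "real (card (A \<inter> {..n})) ^ card (J - S) \<le> (C_count * G n) ^ card (J - S)"
    using count_le[OF n_ge] by (intro power_mono) auto
  also have "\<dots> \<le> C_count ^ h * G n ^ (l - 1)"
    unfolding power_mult_distrib using ge_1 card_diff l_bounds
    by (intro mult_mono power_increasing) auto
  finally have "D * (G n / real n) * real (card (A \<inter> {..n})) ^ card (J - S)
      \<le> D * (G n / real n) * (C_count ^ h * G n ^ (l - 1))"
    using D_ge ge_1 by (intro mult_left_mono) auto
  also have "\<dots> = D * C_count ^ h * (G n ^ Suc (l - 1) / real n)" by simp
  finally show ?thesis
    using sum_p_num_top_reps_le[OF n_ge J_sub, of "{..n}" n] card_diff by simp
qed

lemma num_reps_le_if_sum_num_top_reps_le:
  assumes J_sub: "J \<subseteq> I" "J \<noteq> {}" and "0 \<le> c"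
    and bound: "\<And>S. S \<subseteq> J \<Longrightarrow> S \<noteq> {} \<Longrightarrow> (\<Sum>k\<in>A \<inter> {..n}. real (num_top_reps b J S n k A)) \<le> c"
  shows "real (num_reps b J A n) \<le> 2 ^ h * c"
proof -
  note fin = finite_index[OF J_sub(1)]
  have "real (num_reps b J A n) = (\<Sum>S\<in>Pow J - {{}}. \<Sum>k\<in>A \<inter> {..n}. real (num_top_reps b J S n k A))"
    by (simp add: num_reps_eq_sum_num_top_reps[OF fin J_sub(2) b_pos_subset[OF J_sub(1)]])
  also have "\<dots> \<le> (\<Sum>S\<in>Pow J - {{}}. c)" using bound by (intro sum_mono) auto
  also have "\<dots> = real (card (Pow J - {{}})) * c" by simp
  also have "\<dots> \<le> 2 ^ h * c"
  proof (rule mult_right_mono)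
    have "card (Pow J - {{}}) \<le> card (Pow I)" using J_sub finite_I by (intro card_mono) auto
    then have "real (card (Pow J - {{}})) \<le> real (card (Pow I))" by (rule of_nat_mono)
    then show "real (card (Pow J - {{}})) \<le> 2 ^ h" using finite_I by (simp add: card_Pow)
  qed fact
  finally show ?thesis .
qed

lemma num_top_reps_le_if_num_reps_le:
  assumes "J \<subseteq> I" "real (num_reps b (J - S) A (n - sum b S * k)) \<le> c"
  shows "real (num_top_reps b J S n k A) \<le> c"
  using num_top_reps_le_num_reps[OF finite_index b_pos_subset, OF assms(1,1), of S n k A] assms(2)
  by linarith

lemma num_reps_eq_0_below_k0: "J \<subseteq> I \<Longrightarrow> J \<noteq> {} \<Longrightarrow> n < k0 \<Longrightarrow> num_reps b J A n = 0"
  using A_ge by (intro num_reps_eq_0_if_less[of J b A k0] finite_index b_pos_subset)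

lemma sum_num_top_reps_le_if_thin:
  assumes J_sub: "J \<subseteq> I" "S \<subseteq> J" "S \<noteq> {}" "card J \<le> h"
    and n_ge: "k0 \<le> n" "G n ^ card J \<le> real n powr (1 - \<delta>)"
    and j_bounds: "j < h" "\<And>m. real (num_reps b (J - S) A m) \<le> Q ^ j"
  shows "(\<Sum>k\<in>A \<inter> {..n}. real (num_top_reps b J S n k A)) \<le> (1 + 4 / \<delta>) * Q ^ j"
proof -
  note large = ge_k0D[OF n_ge(1)]
  let ?V = "\<Sum>k\<le>n. p k * real (num_top_reps b J S n k A)"
  have rate: "0 < thin_rate j n" "thin_rate j n * Q ^ j = \<delta> / 2 * ln (real n)"
    using \<delta>_range large one_le_Q by (auto simp: thin_rate_def)
  have "thin_rate j n * real (num_top_reps b J S n k A) \<le> thin_rate j n * Q ^ j" for k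
    using rate J_sub j_bounds by (intro mult_left_mono num_top_reps_le_if_num_reps_le) auto
  then have "(\<Sum>k\<in>A \<inter> {..n}. real (num_top_reps b J S n k A))
      \<le> exp (\<delta> / 2 * ln (real n)) * ?V + 2 * ln (real n) / thin_rate j n"
    unfolding rate(2) using n_ge J_sub j_bounds rate(1)
    by (intro sum_num_top_reps_chernoff_bounded) auto
  also have "exp (\<delta> / 2 * ln (real n)) = real n powr (\<delta> / 2)" using large by (simp add: powr_def)
  also have "2 * ln (real n) / thin_rate j n = 4 / \<delta> * Q ^ j"
    using large \<delta>_range one_le_Q by (simp add: thin_rate_def)
  also have "real n powr (\<delta> / 2) * ?V
      \<le> real n powr (\<delta> / 2) * (real n powr (\<delta> / 2) * (real n powr (1 - \<delta>) / real n))"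
  proof (intro mult_left_mono)
    have "?V \<le> D * C_count ^ h * (G n ^ card J / real n)"
      using n_ge J_sub by (intro sum_p_num_top_reps_le_G_power) auto
    also have "\<dots> \<le> real n powr (\<delta> / 2) * (real n powr (1 - \<delta>) / real n)"
      using n_ge(2) sufficiently_large[OF n_ge(1)] G_ge_1[OF n_ge(1)] large
      by (intro mult_mono divide_right_mono) (auto simp: sufficiently_large_def)
    finally show "?V \<le> real n powr (\<delta> / 2) * (real n powr (1 - \<delta>) / real n)" .
  qed simp
  also have "\<dots> = 1" using large by (simp flip: powr_add)
  also have "1 \<le> Q ^ j" using one_le_Q by simp
  finally show ?thesis by (simp add: algebra_simps)
qed

lemma num_reps_le_if_thin:
  assumes "J \<subseteq> I" "card J \<le> h - 1" "k0 \<le> n \<Longrightarrow> G n ^ card J \<le> real n powr (1 - \<delta>)"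
  shows "real (num_reps b J A n) \<le> Q ^ card J"
  using assms
proof (induction "card J" arbitrary: J n rule: less_induct)
  case less
  show ?case
  proof (cases "J = {} \<or> n < k0")
    case True
    then show ?thesis
      using num_reps_empty_index_le[of b A n] num_reps_eq_0_below_k0[of J n] less.prems(1) one_le_Q
      by (cases "J = {}") auto
  next
    case False
    then have n_ge: "k0 \<le> n" and J_nonempty: "J \<noteq> {}" by auto
    have "real (num_reps b (J - S) A m) \<le> Q ^ (card J - 1)" if S_sub: "S \<subseteq> J" "S \<noteq> {}" for S m
    proof -
      have smaller: "card (J - S) < card J"
        using S_sub finite_index[OF less.prems(1)] by (intro psubset_card_mono) auto
      then have "real (num_reps b (J - S) A m) \<le> Q ^ card (J - S)"
        using less.prems G_power_le_if_card_le by (intro less.hyps) auto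
      also have "\<dots> \<le> Q ^ (card J - 1)" using one_le_Q smaller by (intro power_increasing) auto
      finally show ?thesis .
    qed
    then have "real (num_reps b J A n) \<le> 2 ^ h * ((1 + 4 / \<delta>) * Q ^ (card J - 1))"
      using less.prems n_ge J_nonempty \<delta>_range one_le_Q two_le_card_I
      by (intro num_reps_le_if_sum_num_top_reps_le sum_num_top_reps_le_if_thin) auto
    also have "\<dots> = Q ^ Suc (card J - 1)" by (simp add: Q_def)
    also have "Suc (card J - 1) = card J"
      using J_nonempty finite_index[OF less.prems(1)] by (simp add: card_gt_0_iff)
    finally show ?thesis .
  qed
qed

lemma num_reps_le_if_card_le:
  assumes "J \<subseteq> I" "card J \<le> h - 2"
  shows "real (num_reps b J A n) \<le> Q ^ h"
proof -
  have "real (num_reps b J A n) \<le> Q ^ card J"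
    using assms G_power_le_if_card_le by (intro num_reps_le_if_thin) auto
  also have "\<dots> \<le> Q ^ h" using assms one_le_Q by (intro power_increasing) auto
  finally show ?thesis .
qed

lemma sum_num_top_reps_le_\<psi>:
  assumes J_sub: "J \<subseteq> I" "card J \<le> h - 1" and S_sub: "S \<subseteq> J" "S \<noteq> {}" and n_ge: "k0 \<le> n"
  shows "(\<Sum>k\<in>A \<inter> {..n}. real (num_top_reps b J S n k A))
    \<le> (3 * D * C_count ^ h * (K ^ (h - 1) * B) + 2 * Q ^ h * B) * \<psi> n"
proof -
  note large = ge_k0D[OF n_ge]
  let ?V = "\<Sum>k\<le>n. p k * real (num_top_reps b J S n k A)"
  have "card (J - S) < card J"
    using S_sub finite_index[OF J_sub(1)] by (intro psubset_card_mono) auto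
  then have "real (num_reps b (J - S) A m) \<le> Q ^ h" for m
    using J_sub by (intro num_reps_le_if_card_le) auto
  then have "\<psi>_rate n * real (num_top_reps b J S n k A) \<le> 1" for k
    using J_sub one_le_Q num_top_reps_le_if_num_reps_le[OF J_sub(1), of S n k "Q ^ h"]
    by (simp add: \<psi>_rate_def)
  then have "(\<Sum>k\<in>A \<inter> {..n}. real (num_top_reps b J S n k A))
      \<le> exp 1 * ?V + 2 * ln (real n) / \<psi>_rate n"
    using n_ge S_sub J_sub one_le_Q
    by (intro sum_num_top_reps_chernoff_bounded) (auto simp: \<psi>_rate_def)
  also have "exp 1 * ?V \<le> 3 * (D * C_count ^ h * (K ^ (h - 1) * B * \<psi> n))"
  proof (intro mult_mono)
    have "?V \<le> D * C_count ^ h * (G n ^ (h - 1) / real n)"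
      using n_ge J_sub S_sub by (intro sum_p_num_top_reps_le_G_power) auto
    also have "\<dots> \<le> D * C_count ^ h * (K ^ (h - 1) * B * \<psi> n)"
      using G_upper[OF n_ge] D_ge one_le_C_count large
      by (intro mult_left_mono) (auto simp: divide_le_eq mult_ac)
    finally show "?V \<le> D * C_count ^ h * (K ^ (h - 1) * B * \<psi> n)" .
  qed (use exp_le p_nonneg in \<open>auto intro!: sum_nonneg\<close>)
  also have "2 * ln (real n) / \<psi>_rate n \<le> 2 * Q ^ h * (B * \<psi> n)"
    using ln_le_\<psi>[OF large(1)] one_le_Q by (simp add: \<psi>_rate_def mult_left_mono)
  finally show ?thesis by (simp add: algebra_simps)
qed

lemma num_reps_le_\<psi>:
  assumes J_sub: "J \<subseteq> I" "card J \<le> h - 1" and n_ge: "k0 \<le> n" "m \<le> n"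
  shows "real (num_reps b J A m) \<le> C_\<psi> * \<psi> n"
proof (cases "J \<noteq> {} \<and> k0 \<le> m")
  case True
  then have "k0 \<le> m" by simp
  have "0 \<le> 3 * D * C_count ^ h * (K ^ (h - 1) * B) + 2 * Q ^ h * B"
    using D_ge one_le_C_count K_ge one_le_B one_le_Q by simp
  then have "real (num_reps b J A m)
      \<le> 2 ^ h * ((3 * D * C_count ^ h * (K ^ (h - 1) * B) + 2 * Q ^ h * B) * \<psi> m)"
    using True J_sub \<psi>_pos[OF \<open>k0 \<le> m\<close>]
    by (intro num_reps_le_if_sum_num_top_reps_le sum_num_top_reps_le_\<psi> mult_nonneg_nonneg) auto
  also have "\<dots> = C_\<psi> * \<psi> m" by (simp add: C_\<psi>_def)
  also have "\<dots> \<le> C_\<psi> * \<psi> n"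
    using C_\<psi>_ge \<psi>_mono[of m n] ge_k0D[OF \<open>k0 \<le> m\<close>] n_ge by (intro mult_left_mono) auto
  finally show ?thesis .
next
  case False
  then have "real (num_reps b J A m) \<le> Q ^ card J"
    using J_sub num_reps_empty_index_le[of b A m] num_reps_eq_0_below_k0[of J m] one_le_Q
    by (cases "J = {}") auto
  also have "\<dots> \<le> Q ^ h" using one_le_Q J_sub by (intro power_increasing) auto
  also have "\<dots> \<le> C_\<psi> * \<psi> n" by (rule Q_power_le_C_\<psi>[OF n_ge(1)])
  finally show ?thesis .
qed

lemma num_reps_le_W:
  assumes J_sub: "J \<subseteq> I" "card J \<le> h - 1" and n_ge: "k0 \<le> n" "m \<le> n"
    and m_ge: "card J \<le> h - 2 \<or> real n powr (1 - \<delta>) \<le> real m"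
  shows "real (num_reps b J A m) \<le> W n"
proof (cases "card J \<le> h - 2")
  case True
  then show ?thesis
    using num_reps_le_if_card_le[OF J_sub(1)] Q_power_le_W[OF n_ge(1)] by (meson order_trans)
next
  case False
  then have m_ge: "real n powr (1 - \<delta>) \<le> real m" using m_ge by simp
  show ?thesis
  proof (cases "thin n")
    case True
    then have "real (num_reps b J A m) \<le> Q ^ card J"
      using J_sub n_ge m_ge thin_imp_G_power_le by (intro num_reps_le_if_thin) auto
    also have "\<dots> \<le> Q ^ h" using J_sub one_le_Q by (intro power_increasing) auto
    finally show ?thesis using True by (simp add: W_def)
  qed (use num_reps_le_\<psi>[OF J_sub n_ge] in \<open>simp add: W_def\<close>)
qed

lemma full_rate_bounds:
  assumes n_ge: "k0 \<le> n"
  shows "0 < full_rate n" "full_rate n * W n \<le> 1" "full_rate n * (C_\<psi> * \<psi> n) \<le> \<sigma> * ln (real n)"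
    "2 * ln (real n) / full_rate n = T * \<mu> n"
proof -
  have pos: "0 < T" "1 \<le> \<mu> n" "0 < T * \<mu> n" "1 \<le> ln (real n)"
    using T_ge(1) \<mu>_ge_1[OF n_ge] ge_k0D[OF n_ge] by auto
  then show "0 < full_rate n" "2 * ln (real n) / full_rate n = T * \<mu> n"
    by (auto simp: full_rate_def)
  have "1 * (2 * ln (real n) * W n) \<le> 8 * W n * ln (real n)"
    using pos W_pos[OF n_ge] by simp
  also have "\<dots> \<le> c_reps * \<mu> n" by (rule W_ln_le[OF n_ge])
  also have "\<dots> \<le> T * \<mu> n" using c_reps_range T_ge pos by (intro mult_right_mono) auto
  finally show "full_rate n * W n \<le> 1" using pos by (simp add: full_rate_def divide_le_eq)
  have "2 * ln (real n) * (C_\<psi> * \<psi> n) \<le> 2 * ln (real n) * (C_\<psi> * (B * \<mu> n))"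
    using \<psi>_le_\<mu>[OF n_ge] C_\<psi>_ge pos by (intro mult_left_mono) auto
  also have "\<dots> = 2 * C_\<psi> * B * (\<mu> n * ln (real n))" by simp
  also have "\<dots> \<le> \<sigma> * T * (\<mu> n * ln (real n))" using T_ge pos by (intro mult_right_mono) auto
  finally show "full_rate n * (C_\<psi> * \<psi> n) \<le> \<sigma> * ln (real n)"
    using pos by (simp add: full_rate_def divide_le_eq mult_ac)
qed

lemma two_powr_minus_\<sigma>_le_1:
  assumes n_ge: "k0 \<le> n"
  shows "2 * real n powr (- 2 * \<sigma>) \<le> 1"
proof -
  have "1 * 1 \<le> D * C_count ^ (h - 1)" using D_ge one_le_C_count by (intro mult_mono) auto
  then have "2 \<le> real n powr \<sigma>"
    using sufficiently_large[OF n_ge] by (simp add: sufficiently_large_def)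
  then have "2 * 1 \<le> real n powr \<sigma> * real n powr \<sigma>" by (intro mult_mono) auto
  then show ?thesis using ge_k0D[OF n_ge] by (simp add: powr_minus field_simps flip: powr_add)
qed

lemma count_le_if_le_powr:
  assumes n_ge: "k0 \<le> n" and M_le: "real M \<le> real n powr (1 - \<delta>)"
  shows "real (card (A \<inter> {..M})) \<le> C_count * (2 * real n powr (- 2 * \<sigma>) * G n)"
proof (cases "k0 \<le> M")
  case True
  note M_le
  also have "real n powr (1 - \<delta>) \<le> real n powr 1"
    using ge_k0D[OF n_ge] \<delta>_range by (intro powr_mono) auto
  finally have "M \<le> n" using ge_k0D[OF n_ge] by simp
  have "real (card (A \<inter> {..M})) \<le> C_count * G M" by (rule count_le[OF True])
  also have "\<dots> \<le> C_count * (2 * real n powr (- 2 * \<sigma>) * G n)"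
    using G_le_if_le_powr[OF True \<open>M \<le> n\<close> M_le] one_le_C_count by (intro mult_left_mono) auto
  finally show ?thesis .
next
  case False
  then show ?thesis using A_atMost_eq_empty one_le_C_count G_ge_1[OF n_ge] by simp
qed

text \<open>The power growth of \<open>G\<close> makes the contribution of the \<open>k\<close> for which the remaining entries
  sum to at most \<open>n powr (1 - \<delta>)\<close> negligible.\<close>

lemma sum_near_num_top_reps_le:
  assumes n_ge: "k0 \<le> n" and S_sub: "S \<subseteq> I" "S \<noteq> {}" "card (I - S) = h - 1"
    and N_bound: "finite N" "\<And>k. k \<in> N \<Longrightarrow> real (n - sum b S * k) \<le> real n powr (1 - \<delta>)"
  shows "real n powr \<sigma> * (\<Sum>k\<in>N. p k * real (num_top_reps b I S n k A)) \<le> \<mu> n"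
proof -
  define M where "M = nat \<lfloor>real n powr (1 - \<delta>)\<rfloor>"
  define x where "x = 2 * real n powr (- 2 * \<sigma>)"
  have x_range: "0 \<le> x" "x \<le> 1" using two_powr_minus_\<sigma>_le_1[OF n_ge] by (auto simp: x_def)
  have "real (card (A \<inter> {..M})) \<le> C_count * (x * G n)"
    unfolding x_def by (rule count_le_if_le_powr[OF n_ge]) (simp add: M_def)
  then have "real (card (A \<inter> {..M})) ^ (h - 1) \<le> (C_count * (x * G n)) ^ (h - 1)"
    by (intro power_mono) auto
  also have "\<dots> = C_count ^ (h - 1) * (x ^ (h - 1) * G n ^ (h - 1))"
    by (simp add: power_mult_distrib)
  also have "\<dots> \<le> C_count ^ (h - 1) * (x ^ 1 * G n ^ (h - 1))"
    using one_le_C_count x_range G_ge_1[OF n_ge] two_le_card_I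
    by (intro mult_left_mono mult_right_mono power_decreasing) auto
  finally have card_power_le: "real (card (A \<inter> {..M})) ^ (h - 1)
      \<le> C_count ^ (h - 1) * (x ^ 1 * G n ^ (h - 1))" .
  have "(\<Sum>k\<in>N. p k * real (num_top_reps b I S n k A))
      \<le> D * (G n / real n) * real (card (A \<inter> {..M})) ^ card (I - S)"
    using N_bound
    by (intro sum_p_num_top_reps_le n_ge S_sub order_refl) (auto simp: M_def le_nat_floor)
  also have "\<dots> \<le> D * (G n / real n) * (C_count ^ (h - 1) * (x ^ 1 * G n ^ (h - 1)))"
    unfolding S_sub(3) using D_ge G_ge_1[OF n_ge] card_power_le by (intro mult_left_mono) auto
  also have "\<dots> = 2 * D * C_count ^ (h - 1) * real n powr (- 2 * \<sigma>) * (G n ^ Suc (h - 1) / real n)"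
    by (simp add: x_def)
  also have "\<dots> = 2 * D * C_count ^ (h - 1) * real n powr (- 2 * \<sigma>) * \<mu> n"
    using two_le_card_I by (simp add: \<mu>_def)
  also have "\<dots> \<le> real n powr \<sigma> * real n powr (- 2 * \<sigma>) * \<mu> n"
    using sufficiently_large[OF n_ge] \<mu>_ge_1[OF n_ge]
    by (intro mult_right_mono) (auto simp: sufficiently_large_def)
  also have "\<dots> = real n powr (- \<sigma>) * \<mu> n" by (simp flip: powr_add)
  finally have "(\<Sum>k\<in>N. p k * real (num_top_reps b I S n k A)) \<le> real n powr (- \<sigma>) * \<mu> n" .
  then have "real n powr \<sigma> * (\<Sum>k\<in>N. p k * real (num_top_reps b I S n k A))
      \<le> real n powr \<sigma> * (real n powr (- \<sigma>) * \<mu> n)" by (intro mult_left_mono) auto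
  then show ?thesis using ge_k0D[OF n_ge] by (simp flip: powr_add mult.assoc)
qed

lemma exp_full_rate_num_top_reps_le:
  assumes n_ge: "k0 \<le> n" and S_sub: "S \<subseteq> I" "S \<noteq> {}"
  shows "exp (full_rate n * real (num_top_reps b I S n k A)) \<le> real n powr \<sigma>"
    and "card (I - S) \<le> h - 2 \<or> real n powr (1 - \<delta>) \<le> real (n - sum b S * k) \<Longrightarrow>
      exp (full_rate n * real (num_top_reps b I S n k A)) \<le> 3"
proof -
  let ?w = "real (num_top_reps b I S n k A)"
  note rate = full_rate_bounds[OF n_ge]
  have "card (I - S) < h" using S_sub finite_I by (intro psubset_card_mono) auto
  then have card_diff: "card (I - S) \<le> h - 1" by simp
  have "?w \<le> C_\<psi> * \<psi> n"
    using card_diff by (intro num_top_reps_le_if_num_reps_le num_reps_le_\<psi> n_ge) auto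
  then have "full_rate n * ?w \<le> full_rate n * (C_\<psi> * \<psi> n)" using rate by (intro mult_left_mono) auto
  then show "exp (full_rate n * ?w) \<le> real n powr \<sigma>"
    using rate(3) ge_k0D[OF n_ge] by (simp add: powr_def)
  assume "card (I - S) \<le> h - 2 \<or> real n powr (1 - \<delta>) \<le> real (n - sum b S * k)"
  then have "?w \<le> W n"
    using card_diff by (intro num_top_reps_le_if_num_reps_le num_reps_le_W n_ge) auto
  then have "full_rate n * ?w \<le> full_rate n * W n" using rate by (intro mult_left_mono) auto
  then have "exp (full_rate n * ?w) \<le> exp 1" using rate(2) by (subst exp_le_cancel_iff) linarith
  also have "exp (1 :: real) \<le> 3" by (rule exp_le)
  finally show "exp (full_rate n * ?w) \<le> 3" .
qed

lemma sum_num_top_reps_le_\<mu>: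
  assumes n_ge: "k0 \<le> n" and S_sub: "S \<subseteq> I" "S \<noteq> {}"
  shows "(\<Sum>k\<in>A \<inter> {..n}. real (num_top_reps b I S n k A)) \<le> (3 * D * C_count ^ h + 1 + T) * \<mu> n"
proof -
  let ?w = "\<lambda>k. real (num_top_reps b I S n k A)"
  define N where
    "N = {k\<in>{..n}. \<not> (card (I - S) \<le> h - 2 \<or> real n powr (1 - \<delta>) \<le> real (n - sum b S * k))}"
  have "card (I - S) < h" using S_sub finite_I by (intro psubset_card_mono) auto
  then have card_eq: "card (I - S) = h - 1" if "N \<noteq> {}" using that by (auto simp: N_def)
  have "exp (full_rate n * ?w k) \<le> 3 + of_bool (k \<in> N) * real n powr \<sigma>" if "k \<le> n" for k
  proof (cases "k \<in> N")
    case True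
    then show ?thesis using exp_full_rate_num_top_reps_le(1)[OF n_ge S_sub, of k] by simp
  next
    case False
    then have "exp (full_rate n * ?w k) \<le> 3"
      using that by (intro exp_full_rate_num_top_reps_le(2)[OF n_ge S_sub]) (auto simp: N_def)
    then show ?thesis using False by simp
  qed
  then have "(\<Sum>k\<le>n. p k * (?w k * exp (full_rate n * ?w k)))
      \<le> (\<Sum>k\<le>n. p k * (?w k * (3 + of_bool (k \<in> N) * real n powr \<sigma>)))"
    using p_nonneg by (intro sum_mono mult_left_mono) auto
  also have "\<dots> = 3 * (\<Sum>k\<le>n. p k * ?w k) +
      real n powr \<sigma> * (\<Sum>k\<le>n. of_bool (k \<in> N) * (p k * ?w k))"
    by (simp add: algebra_simps sum.distrib sum_distrib_left)
  also have "(\<Sum>k\<le>n. of_bool (k \<in> N) * (p k * ?w k)) = (\<Sum>k\<in>N. p k * ?w k)"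
    by (rule sum.mono_neutral_cong_right) (auto simp: N_def)
  also have "real n powr \<sigma> * \<dots> \<le> \<mu> n"
  proof (cases "N = {}")
    case True
    then show ?thesis using \<mu>_ge_1[OF n_ge] by simp
  next
    case False
    show ?thesis
      by (rule sum_near_num_top_reps_le[OF n_ge S_sub card_eq[OF False]]) (auto simp: N_def)
  qed
  also have "(\<Sum>k\<le>n. p k * ?w k) \<le> D * C_count ^ h * \<mu> n"
    unfolding \<mu>_def using S_sub by (intro sum_p_num_top_reps_le_G_power n_ge) auto
  finally have "(\<Sum>k\<le>n. p k * (?w k * exp (full_rate n * ?w k)))
      \<le> 3 * (D * C_count ^ h * \<mu> n) + \<mu> n" by simp
  then show ?thesis
    using sum_num_top_reps_chernoff[OF n_ge S_sub(1) order_refl, of full_rate]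
      full_rate_bounds[OF n_ge]
    by (simp add: algebra_simps)
qed

lemma num_reps_le_\<mu>:
  assumes n_ge: "k0 \<le> n"
  shows "real (num_reps b I A n) \<le> 2 ^ h * ((3 * D * C_count ^ h + 1 + T) * \<mu> n)"
  using two_le_card_I D_ge one_le_C_count T_ge \<mu>_ge_1[OF n_ge]
  by (intro num_reps_le_if_sum_num_top_reps_le sum_num_top_reps_le_\<mu> n_ge) auto

subsection \<open>Lower bound for the number of representations\<close>

lemma num_low_reps_posD:
  assumes "0 < num_low_reps n k A"
  shows "k \<le> n" "n \<le> E * k" "n \<le> E * (n - b pivot * k)"
    "num_low_reps n k A \<le> num_reps b (I - {pivot}) A (n - b pivot * k)"
proof -
  let ?m = "n - b pivot * k"
  have fin: "finite (I - {pivot})" "\<forall>i\<in>I - {pivot}. b i > 0" using finite_I b_pos by auto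
  have others_nonempty: "I - {pivot} \<noteq> {}"
  proof
    assume "I - {pivot} = {}"
    then have "card I \<le> card {pivot}" by (intro card_mono) auto
    then show False using two_le_card_I by simp
  qed
  have low_pos: "0 < num_reps b (I - {pivot}) (A \<inter> window n \<inter> {..<k}) ?m"
    and low_eq: "num_low_reps n k A = num_reps b (I - {pivot}) (A \<inter> window n \<inter> {..<k}) ?m"
    and "b pivot * k \<le> n"
    using assms by (auto simp: num_low_reps_def num_top_reps_def split: if_splits)
  have "1 * k \<le> b pivot * k" using b_pivot_range by (intro mult_le_mono1) simp
  then show "k \<le> n" using \<open>b pivot * k \<le> n\<close> by linarith
  have "A \<inter> window n \<inter> {..<k} \<noteq> {}"
    using low_pos num_reps_eq_0_if_less[OF fin others_nonempty, of "{}" "Suc ?m" ?m] by auto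
  then have "n div E < k" by (auto simp: window_def)
  then show "n \<le> E * k" using E_ge(3) by (simp add: div_less_iff_less_mult mult.commute)
  have "A \<inter> window n \<inter> {..<k} \<subseteq> {Suc (n div E)..}" by (auto simp: window_def)
  then have "\<not> ?m < Suc (n div E)"
    using low_pos num_reps_eq_0_if_less[OF fin others_nonempty] by fastforce
  then show "n \<le> E * ?m"
    using E_ge(3) by (simp add: div_less_iff_less_mult mult.commute not_less_eq)
  show "num_low_reps n k A \<le> num_reps b (I - {pivot}) A ?m"
    unfolding low_eq by (intro num_reps_mono fin) auto
qed

lemma num_low_reps_le_W:
  assumes n_ge: "k0 \<le> n"
  shows "real (num_low_reps n k A) \<le> W n"
proof (cases "num_low_reps n k A = 0")
  case True
  then show ?thesis using W_pos[OF n_ge] by simp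
next
  case False
  define m where "m = n - b pivot * k"
  have "real (num_reps b (I - {pivot}) A m) \<le> W n"
  proof (rule num_reps_le_W[OF _ _ n_ge])
    have "real n powr (1 - \<delta>) * real E \<le> real n powr (1 - \<delta>) * real n powr \<delta>"
      using sufficiently_large[OF n_ge]
      by (intro mult_left_mono) (auto simp: sufficiently_large_def)
    also have "\<dots> = real n" using ge_k0D[OF n_ge] by (simp flip: powr_add)
    also have "\<dots> \<le> real m * real E"
      using num_low_reps_posD(3) False by (simp add: m_def mult.commute flip: of_nat_mult)
    finally show "card (I - {pivot}) \<le> h - 2 \<or> real n powr (1 - \<delta>) \<le> real m" using E_ge(3) by simp
  qed (use pivot_in_I finite_I in \<open>auto simp: m_def\<close>)
  moreover have "num_low_reps n k A \<le> num_reps b (I - {pivot}) A m"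
    using num_low_reps_posD(4) False by (simp add: m_def)
  ultimately show ?thesis by linarith
qed

lemma sum_num_low_reps_ge:
  assumes n_ge: "E * k0 \<le> n"
  shows "(c_count * G n) ^ (h - 1) \<le> real (\<Sum>k\<le>n. num_low_reps n k A)"
proof -
  note large = ge_E_k0D[OF n_ge]
  obtain \<rho> where \<rho>_residue: "\<And>i. \<rho> i < b pivot"
    "\<And>\<kappa>. \<forall>i\<in>I - {pivot}. \<kappa> i mod b pivot = \<rho> i \<Longrightarrow>
      (\<Sum>i\<in>I - {pivot}. b i * \<kappa> i) mod b pivot = n mod b pivot"
    using ex_residues_solving_congruence[OF finite_I pivot_in_I _ Gcd_b_eq_1, of n] b_pivot_range
    by auto
  let ?R = "\<lambda>i. {k \<in> A \<inter> window n. k mod b pivot = \<rho> i}"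
  have "8 * sum b I * (n div E) \<le> E * (n div E)" using E_ge(1) by (rule mult_le_mono1)
  also have "\<dots> \<le> n" by simp
  finally have sum_b: "sum b I * (2 * (n div E)) < n" using ge_k0D[OF large(1)] by simp
  have "(c_count * G n) ^ (h - 1) = (\<Prod>i\<in>I - {pivot}. c_count * G n)"
    using pivot_in_I finite_I by simp
  also have "\<dots> \<le> (\<Prod>i\<in>I - {pivot}. real (card (?R i)))"
    using count_residue_ge[OF n_ge \<rho>_residue(1)] c_count_range G_ge_1[OF large(1)]
    by (intro prod_mono) auto
  also have "\<dots> \<le> real (\<Sum>k\<le>n. num_low_reps n k A)"
    unfolding num_low_reps_def using sum_b
    by (subst of_nat_prod[symmetric], intro of_nat_mono prod_card_residues_le_sum_num_top_reps
        [OF finite_I b_pos pivot_in_I _ sum_b \<rho>_residue(2)]) (auto simp: window_def)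
  finally show ?thesis .
qed

lemma sum_p_num_low_reps_ge:
  assumes n_ge: "E * k0 \<le> n"
  shows "c_reps * \<mu> n \<le> (\<Sum>k\<le>n. p k * real (num_low_reps n k A))"
proof -
  note large = ge_E_k0D[OF n_ge]
  have pos: "0 \<le> G n / (D * real n)" using D_ge G_ge_1[OF large(1)] by simp
  have "G n / (D * real n) * real (num_low_reps n k A) \<le> p k * real (num_low_reps n k A)" for k
  proof (cases "num_low_reps n k A = 0")
    case False
    then have k_bounds: "k \<le> n" "n \<le> E * k" using num_low_reps_posD by auto
    have "E * k0 \<le> E * k" using n_ge k_bounds by linarith
    then have "k0 \<le> k" using E_ge(3) by simp
    then show ?thesis using k_bounds by (intro mult_right_mono p_ge) auto
  qed simp
  then have "G n / (D * real n) * real (\<Sum>k\<le>n. num_low_reps n k A)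
      \<le> (\<Sum>k\<le>n. p k * real (num_low_reps n k A))"
    by (simp add: sum_distrib_left sum_mono)
  moreover have "G n / (D * real n) * (c_count * G n) ^ (h - 1)
      \<le> G n / (D * real n) * real (\<Sum>k\<le>n. num_low_reps n k A)"
    using sum_num_low_reps_ge[OF n_ge] pos by (rule mult_left_mono)
  moreover have "G n / (D * real n) * (c_count * G n) ^ (h - 1)
      = c_reps * (G n ^ Suc (h - 1) / real n)"
    by (simp add: c_reps_def power_mult_distrib)
  ultimately show ?thesis using two_le_card_I by (simp add: \<mu>_def)
qed

lemma num_reps_ge_\<mu>:
  assumes n_ge: "E * k0 \<le> n"
  shows "c_reps / 4 * \<mu> n \<le> real (num_reps b I A n)"
proof -
  have n_ge_k0: "k0 \<le> n" by (rule ge_E_k0D[OF n_ge])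
  note W_positive = W_pos[OF n_ge_k0]
  have "c_reps / 4 * \<mu> n \<le> c_reps * \<mu> n / 2 - 2 * ln (real n) / (1 / W n)"
    using W_ln_le[OF n_ge_k0] by (simp add: algebra_simps)
  also have "\<dots> \<le> (\<Sum>k\<le>n. p k * real (num_low_reps n k A)) / 2 - 2 * ln (real n) / (1 / W n)"
    using sum_p_num_low_reps_ge[OF n_ge] by simp
  also have "\<dots> \<le> (\<Sum>k\<in>A \<inter> {..n}. real (num_low_reps n k A))"
    using W_positive test_exponent_le[OF _ n_ge_k0, of "\<lambda>n k X. - (1 / W n * real (num_low_reps n k X))"]
      num_low_reps_le_W[OF n_ge_k0]
    by (intro sum_members_ge[where w = "\<lambda>k X. real (num_low_reps n k X)"] p_nonneg)
      (auto simp: test_exponents_def)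
  also have "\<dots> \<le> (\<Sum>k\<in>A \<inter> {..n}. real (num_top_reps b I {pivot} n k A))"
    unfolding num_low_reps_def using finite_I b_pos
    by (intro sum_mono of_nat_mono num_top_reps_mono) auto
  also have "\<dots> \<le> real (num_reps b I A n)"
    using sum_num_top_reps_le_num_reps[OF finite_I b_pos, of "{pivot}"] pivot_in_I
    by (simp flip: of_nat_sum)
  finally show ?thesis .
qed

end

subsection \<open>Existence of a set of prescribed growth\<close>

context concentrated_set
begin

lemma count_bigtheta: "(\<lambda>n. real (card (A \<inter> {..n}))) \<in> \<Theta>(G)"
proof (rule bigthetaI'[of c_count C_count])
  show "eventually (\<lambda>n. c_count * norm (G n) \<le> norm (real (card (A \<inter> {..n}))) \<and>
      norm (real (card (A \<inter> {..n}))) \<le> C_count * norm (G n)) sequentially"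
    using eventually_ge_at_top[of "E * k0"]
  proof eventually_elim
    case (elim n)
    then show ?case
      using count_ge[OF elim] count_le[of n] G_ge_1[of n] ge_E_k0D(1)[OF elim] by simp
  qed
qed (use c_count_range one_le_C_count in auto)

lemma num_reps_bigtheta: "(\<lambda>n. real (num_reps b I A n)) \<in> \<Theta>(\<mu>)"
proof (rule bigthetaI'[of "c_reps / 4" "2 ^ h * (3 * D * C_count ^ h + 1 + T)"])
  show "eventually (\<lambda>n. c_reps / 4 * norm (\<mu> n) \<le> norm (real (num_reps b I A n)) \<and>
      norm (real (num_reps b I A n)) \<le> 2 ^ h * (3 * D * C_count ^ h + 1 + T) * norm (\<mu> n))
      sequentially"
    using eventually_ge_at_top[of "E * k0"]
  proof eventually_elim
    case (elim n)
    then show ?case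
      using num_reps_ge_\<mu>[OF elim] num_reps_le_\<mu>[of n] \<mu>_ge_1[of n] ge_E_k0D(1)[OF elim]
      by (simp add: mult.assoc)
  qed
  have "0 \<le> 3 * D * C_count ^ h" using D_ge one_le_C_count by simp
  then show "0 < 2 ^ h * (3 * D * C_count ^ h + 1 + T)" using T_ge(1) by (intro mult_pos_pos) auto
qed (use c_reps_range in simp)

end

lemma bigtheta_power_divide_real:
  fixes F G :: "nat \<Rightarrow> real"
  assumes "F \<in> \<Theta>(G)"
  shows "(\<lambda>n. F n ^ k / real n) \<in> \<Theta>(\<lambda>n. G n ^ k / real n)"
proof (rule landau_theta.divide_right)
  show "(\<lambda>n. F n ^ k) \<in> \<Theta>(\<lambda>n. G n ^ k)"
    using landau_o.big_power[OF bigthetaD1[OF assms]]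
      landau_omega.big_power[OF bigthetaD2[OF assms]]
    by (rule bigthetaI)
qed (auto intro: eventually_mono[OF eventually_gt_at_top[of 0]])

context growth_function
begin

lemma G_bigtheta: "G \<in> \<Theta>(F)"
proof (rule bigthetaI'[of "1 / B" K])
  show "eventually (\<lambda>n. 1 / B * norm (F n) \<le> norm (G n) \<and> norm (G n) \<le> K * norm (F n)) sequentially"
    using eventually_ge_at_top[of k0]
  proof eventually_elim
    case (elim n)
    have F_bounds: "0 < F n" "F n \<le> B * real n" using F_pos F_le ge_k0D[OF elim] by auto
    have "1 * 1 * F n \<le> B * K * F n"
      using one_le_B K_ge(2) F_bounds by (intro mult_right_mono mult_mono) auto
    with F_bounds show ?case
      using one_le_B G_ge_1[OF elim] by (auto simp: G_def min_def field_simps)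
  qed
qed (use one_le_B K_ge in auto)

lemma \<mu>_bigtheta: "\<mu> \<in> \<Theta>(\<lambda>n. F n ^ h / real n)"
  unfolding \<mu>_def[abs_def] using G_bigtheta by (rule bigtheta_power_divide_real)

lemma ex_concentrated_set: "\<exists>A. concentrated_set I b F \<psi> B \<Lambda> n0 A"
proof -
  have "\<exists>A. (\<forall>k\<in>A. p k > 0) \<and>
    (\<forall>u\<in>test_exponents. \<forall>n\<ge>k0. \<forall>N. compensated_sum p (u n) A N \<le> 2 * ln (real n))"
    using p_nonneg p_le_1 finite_test_exponents predictable_test_exponents k0_ge(3)
    by (rule simultaneous_exponential_bounds)
  then obtain A where A_props: "\<forall>k\<in>A. p k > 0"
    "\<forall>u\<in>test_exponents. \<forall>n\<ge>k0. \<forall>N. compensated_sum p (u n) A N \<le> 2 * ln (real n)" by blast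
  have "A \<subseteq> {k0..}" using A_props(1) by (auto simp: p_def split: if_splits)
  with A_props(2) have "concentrated_set I b F \<psi> B \<Lambda> n0 A"
    by (intro concentrated_set.intro concentrated_set_axioms.intro growth_function_axioms) auto
  then show ?thesis by blast
qed

lemma ex_set_of_growth:
  "\<exists>A. 0 \<notin> A \<and> (\<lambda>n. real (card (A \<inter> {..n}))) \<in> \<Theta>(F) \<and>
    (\<lambda>n. real (num_reps b I A n)) \<in> \<Theta>(\<lambda>n. F n ^ h / real n)"
proof -
  obtain A where "concentrated_set I b F \<psi> B \<Lambda> n0 A" using ex_concentrated_set by blast
  then interpret concentrated_set I b F \<psi> B \<Lambda> n0 A .
  have "0 \<notin> A" using A_ge k0_ge(4) by auto
  then show ?thesis
    using landau_theta.trans[OF count_bigtheta G_bigtheta]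
      landau_theta.trans[OF num_reps_bigtheta \<mu>_bigtheta]
    by blast
qed

end

lemma bigo_imp_eventually_const:
  assumes "f \<in> O[F](g)"
  shows "eventually (\<lambda>c. eventually (\<lambda>x. norm (f x) \<le> c * norm (g x)) F) at_top"
proof -
  obtain c where "eventually (\<lambda>x. norm (f x) \<le> c * norm (g x)) F"
    using assms by (rule landau_o.bigE)
  then have "eventually (\<lambda>x. norm (f x) \<le> c' * norm (g x)) F" if "c \<le> c'" for c'
    by (rule eventually_mono) (meson mult_right_mono norm_ge_zero order_trans that)
  then show ?thesis by (rule eventually_mono[OF eventually_ge_at_top])
qed

theorem basis_of_prescribed_growth:
  fixes b :: "'i \<Rightarrow> nat" and F \<psi> :: "nat \<Rightarrow> real"
  assumes index_set: "finite I" "2 \<le> card I" "\<forall>i\<in>I. b i > 0" "Gcd (b ` I) = 1"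
    and pos: "eventually (\<lambda>n. 0 < F n) sequentially" "eventually (\<lambda>n. 0 < \<psi> n) sequentially"
    and mono: "mono_on {1..} F" "mono_on {1..} \<psi>"
    and doubling: "(\<lambda>n. F (2 * n)) \<in> O(F)"
    and growth: "2 \<le> \<Lambda>" "eventually (\<lambda>n. 2 * F n \<le> F (\<Lambda> * n)) sequentially"
    and linear: "F \<in> O(\<lambda>n. real n)"
    and lower: "(\<lambda>n. real n * \<psi> n) \<in> O(\<lambda>n. F n ^ card I)"
    and upper: "(\<lambda>n. F n ^ (card I - 1)) \<in> O(\<lambda>n. real n * \<psi> n)"
    and ln: "(\<lambda>n. ln (real n)) \<in> O(\<psi>)" and small: "\<And>e. e > 0 \<Longrightarrow> \<psi> \<in> O(\<lambda>n. real n powr e)"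
  shows "\<exists>A. 0 \<notin> A \<and> (\<lambda>n. real (card (A \<inter> {..n}))) \<in> \<Theta>(F) \<and>
    (\<lambda>n. real (num_reps b I A n)) \<in> \<Theta>(\<lambda>n. F n ^ card I / real n)"
proof -
  have "eventually (\<lambda>B. 1 \<le> B \<and> eventually (\<lambda>n. norm (F (2 * n)) \<le> B * norm (F n) \<and>
      norm (F n) \<le> B * norm (real n) \<and> norm (real n * \<psi> n) \<le> B * norm (F n ^ card I) \<and>
      norm (F n ^ (card I - 1)) \<le> B * norm (real n * \<psi> n) \<and>
      norm (ln (real n)) \<le> B * norm (\<psi> n)) sequentially) at_top"
    unfolding eventually_conj_iff
    by (intro conjI bigo_imp_eventually_const eventually_ge_at_top assms)
  then obtain B :: real where one_le_B: "1 \<le> B"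
    and bounds: "eventually (\<lambda>n. norm (F (2 * n)) \<le> B * norm (F n) \<and>
      norm (F n) \<le> B * norm (real n) \<and> norm (real n * \<psi> n) \<le> B * norm (F n ^ card I) \<and>
      norm (F n ^ (card I - 1)) \<le> B * norm (real n * \<psi> n) \<and>
      norm (ln (real n)) \<le> B * norm (\<psi> n)) sequentially"
    using eventually_happens'[OF trivial_limit_at_top_linorder] by blast
  have "eventually (\<lambda>n. 0 < F n \<and> 2 * F n \<le> F (\<Lambda> * n) \<and> F (2 * n) \<le> B * F n \<and>
      F n \<le> B * real n \<and> real n * \<psi> n \<le> B * F n ^ card I \<and>
      F n ^ (card I - 1) \<le> B * (real n * \<psi> n) \<and> ln (real n) \<le> B * \<psi> n) sequentially"
    using pos growth(2) bounds by eventually_elim auto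
  then obtain n0 where "\<And>n. n0 \<le> n \<Longrightarrow> 0 < F n \<and> 2 * F n \<le> F (\<Lambda> * n) \<and> F (2 * n) \<le> B * F n \<and>
      F n \<le> B * real n \<and> real n * \<psi> n \<le> B * F n ^ card I \<and>
      F n ^ (card I - 1) \<le> B * (real n * \<psi> n) \<and> ln (real n) \<le> B * \<psi> n"
    by (auto simp: eventually_sequentially)
  moreover have "F m \<le> F n" "\<psi> m \<le> \<psi> n" if "max 1 n0 \<le> m" "m \<le> n" for m n
    using that mono by (auto elim!: mono_onD)
  ultimately interpret growth_function I b F \<psi> B \<Lambda> "max 1 n0"
    using index_set one_le_B growth(1) small by unfold_locales auto
  show ?thesis by (rule ex_set_of_growth)
qed

subsection \<open>The logarithmic integral\<close>

locale log_density =
  fixes f :: "real \<Rightarrow> real"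
  assumes f_pos: "\<And>x. 1 \<le> x \<Longrightarrow> 0 < f x"
    and f_integrable: "\<And>y. 1 \<le> y \<Longrightarrow> f integrable_on {1..y}"
    and integral_bigtheta: "(\<lambda>x. integral {1..x} (\<lambda>t. f t / t)) \<in> \<Theta>(f)"
begin

definition F :: "real \<Rightarrow> real" where "F x = integral {1..x} (\<lambda>t. f t / t)"

lemma F_bigtheta: "F \<in> \<Theta>(f)"
  using integral_bigtheta by (simp add: F_def[abs_def])

lemma integrable_from_1: "(\<lambda>t. f t / t) integrable_on {1..y}" if "1 \<le> y"
proof -
  have "f absolutely_integrable_on {1..y}"
    using f_integrable[OF that] f_pos
    by (intro nonnegative_absolutely_integrable_1) (auto intro: less_imp_le)
  then have "(\<lambda>t. inverse t * f t) absolutely_integrable_on {1..y}"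
  proof (intro absolutely_integrable_bounded_measurable_product_real)
    have cont: "continuous_on {1..y} (\<lambda>t::real. inverse t)" by (intro continuous_intros) auto
    show "inverse \<in> borel_measurable (lebesgue_on {1..y})"
      using cont by (intro continuous_imp_measurable_on_sets_lebesgue) auto
    show "bounded (inverse ` {1..y})"
      using compact_continuous_image[OF cont] compact_imp_bounded by blast
  qed auto
  then show ?thesis
    by (simp add: absolutely_integrable_on_def divide_inverse mult.commute)
qed

lemma integrable: "(\<lambda>t. f t / t) integrable_on {x..y}" if "1 \<le> x" "x \<le> y"
  using integrable_on_subinterval[OF integrable_from_1[of y]] that by auto

lemma F_diff: "F y - F x = integral {x..y} (\<lambda>t. f t / t)" if "1 \<le> x" "x \<le> y"
  using Henstock_Kurzweil_Integration.integral_combine[of 1 x y "\<lambda>t. f t / t"]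
    integrable_from_1[of y] that
  by (simp add: F_def)

lemma F_mono: "F x \<le> F y" if "1 \<le> x" "x \<le> y"
proof -
  have "0 \<le> integral {x..y} (\<lambda>t. f t / t)"
    using that f_pos
    by (intro integral_nonneg integrable) (auto intro!: divide_nonneg_nonneg less_imp_le)
  then show ?thesis using F_diff[OF that] by simp
qed

lemma F_comparable_constants:
  obtains C x0 where "1 \<le> C" "1 \<le> x0" "\<And>x. x0 \<le> x \<Longrightarrow> F x \<le> C * f x" "\<And>x. x0 \<le> x \<Longrightarrow> f x \<le> C * F x"
    "\<And>x. x0 \<le> x \<Longrightarrow> 0 < F x"
proof -
  have "eventually (\<lambda>C. 1 \<le> C \<and>
      eventually (\<lambda>x. norm (F x) \<le> C * norm (f x) \<and> norm (f x) \<le> C * norm (F x)) at_top) at_top"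
    unfolding eventually_conj_iff using F_bigtheta
    by (intro conjI bigo_imp_eventually_const eventually_ge_at_top)
      (auto simp: bigtheta_def bigomega_iff_bigo)
  then obtain C :: real where C_bounds: "1 \<le> C"
      "eventually (\<lambda>x. norm (F x) \<le> C * norm (f x) \<and> norm (f x) \<le> C * norm (F x)) at_top"
    using eventually_happens'[OF trivial_limit_at_top_linorder] by blast
  have "eventually (\<lambda>x. 1 \<le> x \<and> F x \<le> C * f x \<and> f x \<le> C * F x \<and> 0 < F x) at_top"
    using C_bounds(2) eventually_ge_at_top[of 1]
  proof eventually_elim
    case (elim x)
    have "0 \<le> F x" using F_mono[of 1 x] elim by (simp add: F_def)
    moreover have "F x \<noteq> 0" using elim f_pos[of x] by auto
    ultimately show ?case using elim f_pos[of x] by simp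
  qed
  then obtain x0 where "\<And>x. x0 \<le> x \<Longrightarrow> 1 \<le> x \<and> F x \<le> C * f x \<and> f x \<le> C * F x \<and> 0 < F x"
    by (auto simp: eventually_at_top_linorder)
  then show ?thesis using that[of C "max 1 x0"] C_bounds(1) by simp
qed

lemma F_eventually_pos: "eventually (\<lambda>x. 0 < F x) at_top"
  by (rule F_comparable_constants) (auto simp: eventually_at_top_linorder)

lemma F_doubling: "(\<lambda>x. F (2 * x)) \<in> O(F)"
proof -
  obtain C x0 where C_bounds: "1 \<le> C" "1 \<le> x0" "\<And>x. x0 \<le> x \<Longrightarrow> f x \<le> C * F x"
    and F_pos: "\<And>x. x0 \<le> x \<Longrightarrow> 0 < F x"
    using F_comparable_constants by metis
  define r where "r = 1 + 1 / (2 * C)"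
  have one_less_r: "1 < r" using C_bounds by (simp add: r_def)
  have step: "F (r * x) \<le> 2 * F x" if x_ge: "x0 \<le> x" for x
  proof -
    have rx_ge: "1 \<le> x" "x \<le> r * x"
      using x_ge C_bounds one_less_r by (auto simp: mult_le_cancel_right1)
    have "0 < F (r * x)" using rx_ge x_ge by (intro F_pos) linarith
    have "F (r * x) - F x = integral {x..r * x} (\<lambda>t. f t / t)" using rx_ge by (intro F_diff)
    also have "\<dots> \<le> integral {x..r * x} (\<lambda>t. C * F (r * x) / x)"
    proof (intro integral_le integrable)
      fix t assume t_in: "t \<in> {x..r * x}"
      have "f t \<le> C * F t" using C_bounds(3) t_in x_ge by simp
      also have "\<dots> \<le> C * F (r * x)"
        using C_bounds(1) t_in rx_ge by (intro mult_left_mono F_mono) auto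
      finally show "f t / t \<le> C * F (r * x) / x"
        using t_in rx_ge f_pos[of t] C_bounds(1) \<open>0 < F (r * x)\<close> by (intro frac_le) auto
    qed (use rx_ge in auto)
    also have "\<dots> = F (r * x) / 2" using rx_ge C_bounds(1) by (simp add: r_def field_simps)
    finally show ?thesis by simp
  qed
  obtain j where r_power: "2 < r ^ j" using real_arch_pow[OF one_less_r] by blast
  have "norm (F (2 * x)) \<le> 2 ^ j * norm (F x)" if x_ge: "x0 \<le> x" for x
  proof -
    have "F (2 * x) \<le> F (r ^ j * x)"
      using r_power x_ge C_bounds(2) by (intro F_mono mult_right_mono) auto
    also have "\<dots> \<le> 2 ^ j * F x"
      using step one_less_r C_bounds(2) x_ge by (intro iterated_scaling_le[of x0]) auto
    finally show ?thesis using F_pos[of x] F_pos[of "2 * x"] x_ge C_bounds(2) by simp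
  qed
  then show ?thesis by (intro bigoI eventually_mono[OF eventually_ge_at_top[of x0]])
qed

lemma F_power_growth: "\<exists>\<Lambda>::nat. 2 \<le> \<Lambda> \<and> eventually (\<lambda>x. 2 * F x \<le> F (real \<Lambda> * x)) at_top"
proof -
  obtain C x0 where C_bounds: "1 \<le> C" "1 \<le> x0" "\<And>x. x0 \<le> x \<Longrightarrow> F x \<le> C * f x"
    and F_pos: "\<And>x. x0 \<le> x \<Longrightarrow> 0 < F x"
    using F_comparable_constants by metis
  define r where "r = 1 + 1 / (2 * C)"
  have one_less_r: "1 < r" using C_bounds by (simp add: r_def)
  have step: "r * F x \<le> F (2 * x)" if x_ge: "x0 \<le> x" for x
  proof -
    have x_ge_1: "1 \<le> x" "x \<le> 2 * x" using x_ge C_bounds by auto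
    have "F x / (2 * C) = integral {x..2 * x} (\<lambda>t. F x / C / (2 * x))" using x_ge_1 by simp
    also have "\<dots> \<le> integral {x..2 * x} (\<lambda>t. f t / t)"
    proof (intro integral_le integrable)
      fix t assume t_in: "t \<in> {x..2 * x}"
      have "F x \<le> F t" using t_in x_ge_1 by (intro F_mono) auto
      also have "\<dots> \<le> C * f t" using C_bounds(3) t_in x_ge by simp
      finally have "F x / C \<le> f t" using C_bounds(1) by (simp add: divide_le_eq mult.commute)
      then show "F x / C / (2 * x) \<le> f t / t"
        using t_in x_ge_1 f_pos[of t] by (intro frac_le) auto
    qed (use x_ge_1 in auto)
    also have "\<dots> = F (2 * x) - F x" using x_ge_1 by (intro F_diff[symmetric])
    finally show ?thesis by (simp add: r_def algebra_simps)
  qed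
  obtain j where r_power: "2 < r ^ j" using real_arch_pow[OF one_less_r] by blast
  have "2 * F x \<le> F (real (2 ^ j) * x)" if x_ge: "x0 \<le> x" for x
  proof -
    have "2 * F x \<le> r ^ j * F x" using r_power F_pos[OF x_ge] by (intro mult_right_mono) auto
    also have "\<dots> \<le> F (2 ^ j * x)"
      using iterated_scaling_le[of x0 "\<lambda>x. - F x" 2 r x j] step one_less_r C_bounds(2) x_ge by simp
    finally show ?thesis by simp
  qed
  moreover have "2 \<le> (2 :: nat) ^ j" using r_power by (cases j) auto
  ultimately show ?thesis
    by (intro exI[of _ "2 ^ j"] conjI eventually_mono[OF eventually_ge_at_top[of x0]])
qed

lemma F_floor_bigtheta: "(\<lambda>x. F (real (nat \<lfloor>x\<rfloor>))) \<in> \<Theta>(F)"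
proof -
  have floor: "1 \<le> real (nat \<lfloor>x\<rfloor>)" "real (nat \<lfloor>x\<rfloor>) \<le> x" "x \<le> 2 * real (nat \<lfloor>x\<rfloor>)"
    if "1 \<le> x" for x :: real
  proof -
    have "1 \<le> \<lfloor>x\<rfloor>" using that by (simp add: le_floor_iff)
    then show "1 \<le> real (nat \<lfloor>x\<rfloor>)" "real (nat \<lfloor>x\<rfloor>) \<le> x" "x \<le> 2 * real (nat \<lfloor>x\<rfloor>)" by linarith+
  qed
  have lim: "filterlim (\<lambda>x :: real. real (nat \<lfloor>x\<rfloor>)) at_top at_top" by real_asymp
  have pos: "eventually (\<lambda>x :: real. 0 < F (real (nat \<lfloor>x\<rfloor>)) \<and> 1 \<le> x) at_top"
    by (intro eventually_conj eventually_ge_at_top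
        eventually_compose_filterlim[OF F_eventually_pos lim])
  have "eventually (\<lambda>x. norm (F (real (nat \<lfloor>x\<rfloor>))) \<le> norm (F x) \<and>
      norm (F x) \<le> norm (F (2 * real (nat \<lfloor>x\<rfloor>)))) at_top"
    using pos
  proof eventually_elim
    case (elim x)
    define y where "y = real (nat \<lfloor>x\<rfloor>)"
    have "0 < F y" "F y \<le> F x" "F x \<le> F (2 * y)"
      using elim floor[of x] by (auto simp: y_def intro!: F_mono)
    then show ?case unfolding y_def[symmetric] by simp
  qed
  then have "(\<lambda>x. F (real (nat \<lfloor>x\<rfloor>))) \<in> O(F)" "F \<in> O(\<lambda>x. F (2 * real (nat \<lfloor>x\<rfloor>)))"
    by (auto intro!: landau_o.big_mono elim: eventually_mono)
  moreover have "(\<lambda>x :: real. F (2 * real (nat \<lfloor>x\<rfloor>))) \<in> O(\<lambda>x. F (real (nat \<lfloor>x\<rfloor>)))"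
    by (rule landau_o.big.compose[OF F_doubling lim])
  ultimately show ?thesis
    by (auto simp: bigomega_iff_bigo intro!: bigthetaI dest: landau_o.big_trans)
qed

lemma ex_set_of_integral_growth:
  assumes index_set: "finite I" "2 \<le> card I" "\<forall>i\<in>I. b i > 0" "Gcd (b ` I) = 1"
    and \<psi>_props: "\<And>x. 1 \<le> x \<Longrightarrow> 0 < \<psi> x" "mono_on {1..} \<psi>"
    and linear: "F \<in> O(\<lambda>x. x)"
    and lower: "(\<lambda>x. x * \<psi> x) \<in> O(\<lambda>x. F x ^ card I)"
    and upper: "(\<lambda>x. F x ^ (card I - 1)) \<in> O(\<lambda>x. x * \<psi> x)"
    and ln: "ln \<in> O(\<psi>)" and small: "\<And>e. e > 0 \<Longrightarrow> \<psi> \<in> O(\<lambda>x. x powr e)"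
  shows "\<exists>A. 0 \<notin> A \<and> (\<lambda>n. real (card (A \<inter> {..n}))) \<in> \<Theta>(\<lambda>n. F (real n)) \<and>
    (\<lambda>n. real (num_reps b I A n)) \<in> \<Theta>(\<lambda>n. F (real n) ^ card I / real n)"
proof -
  note on_nat = landau_o.big.compose[OF _ filterlim_real_sequentially]
  obtain \<Lambda> :: nat where \<Lambda>: "2 \<le> \<Lambda>" "eventually (\<lambda>x. 2 * F x \<le> F (real \<Lambda> * x)) at_top"
    using F_power_growth by blast
  show ?thesis
  proof (rule basis_of_prescribed_growth[OF index_set, of _ "\<lambda>n. \<psi> (real n)", OF _ _ _ _ _ \<Lambda>(1)])
    show "eventually (\<lambda>n. 0 < F (real n)) sequentially"
      using F_eventually_pos filterlim_real_sequentially by (rule eventually_compose_filterlim)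
    show "eventually (\<lambda>n. 0 < \<psi> (real n)) sequentially"
      using \<psi>_props(1) by (auto intro: eventually_mono[OF eventually_ge_at_top[of 1]])
    show "mono_on {1..} (\<lambda>n. F (real n))" by (auto intro!: mono_onI F_mono)
    show "mono_on {1..} (\<lambda>n. \<psi> (real n))"
      using \<psi>_props(2) by (auto intro!: mono_onI elim!: mono_onD)
    show "(\<lambda>n. F (real (2 * n))) \<in> O(\<lambda>n. F (real n))" using on_nat[OF F_doubling] by simp
    show "eventually (\<lambda>n. 2 * F (real n) \<le> F (real (\<Lambda> * n))) sequentially"
      using eventually_compose_filterlim[OF \<Lambda>(2) filterlim_real_sequentially] by simp
  qed (assumption | rule linear[THEN on_nat] lower[THEN on_nat] upper[THEN on_nat]
      ln[THEN on_nat] small[THEN on_nat])+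
qed

lemma ex_set_of_growth:
  assumes index_set: "finite I" "2 \<le> card I" "\<forall>i\<in>I. b i > 0" "Gcd (b ` I) = 1"
    and \<psi>_props: "\<And>x. 1 \<le> x \<Longrightarrow> 0 < \<psi> x" "mono_on {1..} \<psi>"
    and linear: "f \<in> O(\<lambda>x. x)"
    and lower: "(\<lambda>x. x * \<psi> x) \<in> O(\<lambda>x. f x ^ card I)"
    and upper: "(\<lambda>x. f x ^ (card I - 1)) \<in> O(\<lambda>x. x * \<psi> x)"
    and ln: "ln \<in> O(\<psi>)" and small: "\<And>e. e > 0 \<Longrightarrow> \<psi> \<in> O(\<lambda>x. x powr e)"
  shows "\<exists>A. 0 \<notin> A \<and> (\<lambda>x. real (card (A \<inter> {..nat \<lfloor>x\<rfloor>}))) \<in> \<Theta>(f) \<and>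
    (\<lambda>n. real (num_reps b I A n)) \<in> \<Theta>(\<lambda>n. f (real n) ^ card I / real n)"
proof -
  note F_bigo_f = bigthetaD1[OF F_bigtheta]
  have f_bigo_F: "f \<in> O(F)" using F_bigtheta by (simp add: bigtheta_def bigomega_iff_bigo)
  obtain A where A_props: "0 \<notin> A" "(\<lambda>n. real (card (A \<inter> {..n}))) \<in> \<Theta>(\<lambda>n. F (real n))"
    "(\<lambda>n. real (num_reps b I A n)) \<in> \<Theta>(\<lambda>n. F (real n) ^ card I / real n)"
    using ex_set_of_integral_growth[OF index_set \<psi>_props landau_o.big_trans[OF F_bigo_f linear]
        landau_o.big_trans[OF lower landau_o.big_power[OF f_bigo_F]]
        landau_o.big_trans[OF landau_o.big_power[OF F_bigo_f] upper] ln small] by blast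
  have floor: "filterlim (\<lambda>x :: real. nat \<lfloor>x\<rfloor>) sequentially at_top"
    by (intro filterlim_compose[OF filterlim_nat_sequentially] filterlim_floor_sequentially)
  have "(\<lambda>x :: real. real (card (A \<inter> {..nat \<lfloor>x\<rfloor>}))) \<in> \<Theta>(\<lambda>x. F (real (nat \<lfloor>x\<rfloor>)))"
    by (rule landau_theta.compose[OF A_props(2) floor])
  also note F_floor_bigtheta
  also note F_bigtheta
  finally have count: "(\<lambda>x. real (card (A \<inter> {..nat \<lfloor>x\<rfloor>}))) \<in> \<Theta>(f)" .
  have "(\<lambda>n. F (real n)) \<in> \<Theta>(\<lambda>n. f (real n))"
    by (rule landau_theta.compose[OF F_bigtheta filterlim_real_sequentially])
  from landau_theta.trans[OF A_props(3) bigtheta_power_divide_real[OF this]] count A_props(1)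
  show ?thesis by blast
qed

end

lemma bigo_minD:
  fixes f g h :: "'a \<Rightarrow> real"
  assumes "f \<in> O[F](\<lambda>x. min (g x) (h x))" "eventually (\<lambda>x. 0 \<le> g x \<and> 0 \<le> h x) F"
  shows "f \<in> O[F](g)" "f \<in> O[F](h)"
proof -
  have "(\<lambda>x. min (g x) (h x)) \<in> O[F](g)" "(\<lambda>x. min (g x) (h x)) \<in> O[F](h)"
    using assms(2) by (auto intro!: landau_o.big_mono elim!: eventually_mono)
  then show "f \<in> O[F](g)" "f \<in> O[F](h)" using assms(1) landau_o.big_trans by blast+
qed

lemma bigo_power_if_bigo_root:
  fixes g :: "'a \<Rightarrow> real"
  assumes "eventually (\<lambda>x. 0 < g x) F" "0 < k"
  shows "(\<lambda>x. g x powr (1 / real k)) \<in> O[F](f) \<Longrightarrow> g \<in> O[F](\<lambda>x. f x ^ k)"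
    and "f \<in> O[F](\<lambda>x. g x powr (1 / real k)) \<Longrightarrow> (\<lambda>x. f x ^ k) \<in> O[F](g)"
proof -
  have root: "eventually (\<lambda>x. (g x powr (1 / real k)) ^ k = g x) F"
    using assms(1) by eventually_elim (use assms(2) in \<open>simp add: powr_powr flip: powr_realpow\<close>)
  show "g \<in> O[F](\<lambda>x. f x ^ k)" if "(\<lambda>x. g x powr (1 / real k)) \<in> O[F](f)"
    using landau_o.big_power[OF that, of k] landau_o.big.in_cong[OF root] by simp
  show "(\<lambda>x. f x ^ k) \<in> O[F](g)" if "f \<in> O[F](\<lambda>x. g x powr (1 / real k))"
    using landau_o.big_power[OF that, of k] landau_o.big.cong[OF root] by simp
qed

lemma Collect_real_le_eq_atMost_floor:
  fixes A :: "nat set" and x :: real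
  assumes "0 \<notin> A"
  shows "{k\<in>A. 1 \<le> k \<and> real k \<le> x} = A \<inter> {..nat \<lfloor>x\<rfloor>}"
proof -
  have "1 \<le> k \<and> real k \<le> x \<longleftrightarrow> k \<le> nat \<lfloor>x\<rfloor>" if "k \<in> A" for k
  proof -
    have "k \<noteq> 0" using assms that by metis
    then show ?thesis by linarith
  qed
  then show ?thesis unfolding Int_def by (intro Collect_cong) auto
qed

theorem theorem4:
  fixes h :: nat and b :: "nat \<Rightarrow> nat" and \<psi> f :: "real \<Rightarrow> real"
  assumes h2: "h \<ge> 2"
    and bpos: "\<forall>i\<in>{1..h}. b i > 0"
    and bgcd: "Gcd (b ` {1..h}) = 1"
    and sv: "slowly_varying \<psi>"
    and incr: "mono_on {1..} \<psi>"
    and logpsi: "(\<lambda>x. ln x) \<in> O(\<psi>)"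
    and fpos: "\<forall>x\<ge>1. f x > 0"
    and floc: "\<forall>y\<ge>1. f integrable_on {1..y}"
    and lower: "(\<lambda>x. (x * \<psi> x) powr (1 / real h)) \<in> O(f)"
    and upper: "f \<in> O(\<lambda>x. min ((x * \<psi> x) powr (1 / (real h - 1))) x)"
    and intf: "(\<lambda>x. integral {1..x} (\<lambda>t. f t / t)) \<in> \<Theta>(f)"
  shows "\<exists>A :: nat set.
           (\<lambda>x. real (card {k\<in>A. 1 \<le> k \<and> real k \<le> x})) \<in> \<Theta>(f) \<and>
           (\<lambda>n. real (rep_count b A h n)) \<in> \<Theta>(\<lambda>n. f (real n) ^ h / real n)"
proof -
  interpret log_density f using fpos floc intf by unfold_locales auto
  have \<psi>_pos: "0 < \<psi> x" if "1 \<le> x" for x using sv that by (simp add: slowly_varying_def)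
  then have pos: "eventually (\<lambda>x. 0 < x * \<psi> x) at_top"
    by (auto intro: eventually_mono[OF eventually_ge_at_top[of 1]])
  have "eventually (\<lambda>x. 0 \<le> (x * \<psi> x) powr (1 / (real h - 1)) \<and> 0 \<le> x) at_top"
    by (auto intro: eventually_ge_at_top)
  note f_root = bigo_minD(1)[OF upper this] and linear = bigo_minD(2)[OF upper this]
  have "(\<lambda>x. f x ^ (h - 1)) \<in> O(\<lambda>x. x * \<psi> x)"
    using h2 f_root by (intro bigo_power_if_bigo_root(2)[OF pos]) (auto simp: of_nat_diff)
  moreover have "(\<lambda>x. x * \<psi> x) \<in> O(\<lambda>x. f x ^ h)"
    using h2 lower by (intro bigo_power_if_bigo_root(1)[OF pos]) auto
  ultimately obtain A where A: "0 \<notin> A" "(\<lambda>x. real (card (A \<inter> {..nat \<lfloor>x\<rfloor>}))) \<in> \<Theta>(f)"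
    "(\<lambda>n. real (num_reps b {1..h} A n)) \<in> \<Theta>(\<lambda>n. f (real n) ^ h / real n)"
    using ex_set_of_growth[of "{1..h}" b \<psi>] h2 bpos bgcd \<psi>_pos incr linear logpsi
      slowly_varying_bigo_powr[OF sv incr] by auto
  have "{k\<in>A. 1 \<le> k \<and> real k \<le> x} = A \<inter> {..nat \<lfloor>x\<rfloor>}" for x
    by (rule Collect_real_le_eq_atMost_floor[OF A(1)])
  then show ?thesis using A(2,3) by (intro exI[of _ A]) (simp add: rep_count_eq_num_reps)
qed

end
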